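(* Let $(M,g,f)$ be a gradient Ricci soliton, i.e. $\mathrm{Ric}+\mathrm{Hess}_f=\kappa g$ for a constant $\kappa$. For any vector field $V$, $$\mathcal{L}\,\mathcal{P}\,V=\mathcal{P}\,\mathcal{L}\,V\qquad\text{and}\qquad\mathcal{P}\,\nabla\operatorname{div}_f(V)=\nabla\operatorname{div}_f(\mathcal{P}\,V).$$
   Context: $\mathcal{L}=\Delta-\nabla_{\nabla f}$ on tensors. For vector fields, $\operatorname{div}_fV=\operatorname{div}V-\langle V,\nabla f\rangle$; for symmetric $2$-tensors, $(\operatorname{div}_fh)_i=h_{ij,j}-f_jh_{ij}$; $(\operatorname{div}_f^*Y)_{ij}=-\frac12(\nabla_iY_j+\nabla_jY_i)$; and $\mathcal{P}V=\operatorname{div}_f(\operatorname{div}_f^*V)$. Vector fields are smooth. *)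

theory Defs
  imports "HOL-Analysis.Analysis"
begin

section \<open>Smooth functions on open subsets of Euclidean space\<close>

definition partial :: "'n \<Rightarrow> (real^'n::finite \<Rightarrow> real) \<Rightarrow> real^'n \<Rightarrow> real" where
  "partial i F x = frechet_derivative F (at x) (axis i 1)"

fun C_k_on :: "nat \<Rightarrow> (real^'n::finite) set \<Rightarrow> (real^'n \<Rightarrow> real) \<Rightarrow> bool" where
  "C_k_on 0 S F \<longleftrightarrow> continuous_on S F"
| "C_k_on (Suc k) S F \<longleftrightarrow> (\<forall>x\<in>S. F differentiable at x) \<and> (\<forall>i. C_k_on k S (partial i F))"

text \<open>Only used for open \<open>S\<close>.\<close>

definition smooth_on :: "(real^'n::finite) set \<Rightarrow> (real^'n \<Rightarrow> real) \<Rightarrow> bool" where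
  "smooth_on S F \<longleftrightarrow> (\<forall>k. C_k_on k S F)"


section \<open>Smooth manifolds\<close>

text \<open>
  A chart is a pair \<open>(U, \<phi>)\<close>. Only the values of \<open>\<phi>\<close> on \<open>U\<close> matter.
\<close>

type_synonym ('a, 'n) chart = "'a set \<times> ('a \<Rightarrow> real^'n)"

abbreviation chart_dom :: "('a, 'n::finite) chart \<Rightarrow> 'a set" where
  "chart_dom c \<equiv> fst c"

abbreviation chart_map :: "('a, 'n::finite) chart \<Rightarrow> 'a \<Rightarrow> real^'n" where
  "chart_map c \<equiv> snd c"

abbreviation chart_inv :: "('a, 'n::finite) chart \<Rightarrow> real^'n \<Rightarrow> 'a" where
  "chart_inv c \<equiv> the_inv_into (chart_dom c) (chart_map c)"

definition is_chart :: "'a topology \<Rightarrow> ('a, 'n::finite) chart \<Rightarrow> bool" where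
  "is_chart M c \<longleftrightarrow>
     openin M (chart_dom c) \<and>
     open (chart_map c ` chart_dom c) \<and>
     homeomorphic_map (subtopology M (chart_dom c))
       (top_of_set (chart_map c ` chart_dom c)) (chart_map c)"

definition smoothly_compatible :: "('a, 'n::finite) chart \<Rightarrow> ('a, 'n) chart \<Rightarrow> bool" where
  "smoothly_compatible c c' \<longleftrightarrow>
     (\<forall>i. smooth_on (chart_map c ` (chart_dom c \<inter> chart_dom c'))
            (\<lambda>x. chart_map c' (chart_inv c x) $ i))"

text \<open>
  The atlas \<open>A\<close> need not be maximal. The dimension is \<open>CARD('n)\<close>.
\<close>

definition smooth_manifold :: "'a topology \<Rightarrow> ('a, 'n::finite) chart set \<Rightarrow> bool" where
  "smooth_manifold M A \<longleftrightarrow>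
     Hausdorff_space M \<and> second_countable M \<and>
     (\<forall>c\<in>A. is_chart M c) \<and>
     (\<Union>c\<in>A. chart_dom c) = topspace M \<and>
     (\<forall>c\<in>A. \<forall>c'\<in>A. smoothly_compatible c c')"


section \<open>Tensor fields\<close>

text \<open>
  A tensor of type \<open>(r, s)\<close> at a point \<open>p\<close> assigns to every chart around \<open>p\<close> an array of
  components, subject to the usual transformation law. Thus \<open>T p c is js\<close> is the component of
  \<open>T\<close> at \<open>p\<close> in the chart \<open>c\<close> with contravariant (upper) indices \<open>is\<close> and covariant (lower)
  indices \<open>js\<close>. The value is meaningful only if \<open>p\<close> lies in the domain of \<open>c\<close>, \<open>length is = r\<close>
  and \<open>length js = s\<close>; otherwise it is arbitrary. Functions are tensors of type \<open>(0, 0)\<close> and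
  vector fields are tensors of type \<open>(1, 0)\<close>.
\<close>

type_synonym ('a, 'n) tensor_field =
  "'a \<Rightarrow> ('a, 'n) chart \<Rightarrow> 'n list \<Rightarrow> 'n list \<Rightarrow> real"

text \<open>\<open>chart_partial c k u p\<close> is \<open>\<partial>u/\<partial>x\<^sup>k\<close> at \<open>p\<close>, for the coordinates \<open>x\<close> given by \<open>c\<close>.\<close>

definition chart_partial ::
    "('a, 'n::finite) chart \<Rightarrow> 'n \<Rightarrow> ('a \<Rightarrow> real) \<Rightarrow> 'a \<Rightarrow> real" where
  "chart_partial c k u p = partial k (\<lambda>x. u (chart_inv c x)) (chart_map c p)"

text \<open>\<open>jacobian c c' p i j\<close> is \<open>\<partial>x'\<^sup>i/\<partial>x\<^sup>j\<close>, with \<open>x\<close> the coordinates of \<open>c\<close> and \<open>x'\<close> those of \<open>c'\<close>.\<close>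

definition jacobian ::
    "('a, 'n::finite) chart \<Rightarrow> ('a, 'n) chart \<Rightarrow> 'a \<Rightarrow> 'n \<Rightarrow> 'n \<Rightarrow> real" where
  "jacobian c c' p i j = chart_partial c j (\<lambda>q. chart_map c' q $ i) p"

definition is_tensor_field ::
    "('a, 'n::finite) chart set \<Rightarrow> nat \<Rightarrow> nat \<Rightarrow> ('a, 'n) tensor_field \<Rightarrow> bool" where
  "is_tensor_field A r s T \<longleftrightarrow>
     (\<forall>c\<in>A. \<forall>c'\<in>A. \<forall>p\<in>chart_dom c \<inter> chart_dom c'. \<forall>is js. length is = r \<longrightarrow> length js = s \<longrightarrow>
        T p c' is js =
          (\<Sum>as\<in>{as. length as = r}. \<Sum>bs\<in>{bs. length bs = s}.
             (\<Prod>a<r. jacobian c c' p (is ! a) (as ! a)) *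
             (\<Prod>b<s. jacobian c' c p (bs ! b) (js ! b)) *
             T p c as bs))"

definition smooth_tensor_field ::
    "('a, 'n::finite) chart set \<Rightarrow> nat \<Rightarrow> nat \<Rightarrow> ('a, 'n) tensor_field \<Rightarrow> bool" where
  "smooth_tensor_field A r s T \<longleftrightarrow>
     is_tensor_field A r s T \<and>
     (\<forall>c\<in>A. \<forall>is js. length is = r \<longrightarrow> length js = s \<longrightarrow>
        smooth_on (chart_map c ` chart_dom c) (\<lambda>x. T (chart_inv c x) c is js))"

abbreviation smooth_vector_field ::
    "('a, 'n::finite) chart set \<Rightarrow> ('a, 'n) tensor_field \<Rightarrow> bool" where
  "smooth_vector_field A V \<equiv> smooth_tensor_field A 1 0 V"

text \<open>Equality of vector fields on the manifold, i.e. disregarding the arbitrary values.\<close>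

definition vector_field_eq ::
    "('a, 'n::finite) chart set \<Rightarrow> ('a, 'n) tensor_field \<Rightarrow> ('a, 'n) tensor_field \<Rightarrow> bool" where
  "vector_field_eq A V W \<longleftrightarrow> (\<forall>c\<in>A. \<forall>p\<in>chart_dom c. \<forall>i. V p c [i] [] = W p c [i] [])"

definition scalar :: "('a \<Rightarrow> real) \<Rightarrow> ('a, 'n::finite) tensor_field" where
  "scalar u p c is js = u p"

definition smooth_function :: "('a, 'n::finite) chart set \<Rightarrow> ('a \<Rightarrow> real) \<Rightarrow> bool" where
  "smooth_function A u \<longleftrightarrow>
     (\<forall>c\<in>A. smooth_on (chart_map c ` chart_dom c) (\<lambda>x. u (chart_inv c x)))"


section \<open>Riemannian metrics and the Levi-Civita connection\<close>

definition riemannian_metric ::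
    "('a, 'n::finite) chart set \<Rightarrow> ('a, 'n) tensor_field \<Rightarrow> bool" where
  "riemannian_metric A g \<longleftrightarrow>
     smooth_tensor_field A 0 2 g \<and>
     (\<forall>c\<in>A. \<forall>p\<in>chart_dom c.
        (\<forall>i j. g p c [] [i, j] = g p c [] [j, i]) \<and>
        (\<forall>v::real^'n. v \<noteq> 0 \<longrightarrow> (\<Sum>i\<in>UNIV. \<Sum>j\<in>UNIV. g p c [] [i, j] * v $ i * v $ j) > 0))"

text \<open>\<open>g_inv g p c i j\<close> is \<open>g\<^sup>i\<^sup>j\<close>.\<close>

definition g_inv ::
    "('a, 'n::finite) tensor_field \<Rightarrow> 'a \<Rightarrow> ('a, 'n) chart \<Rightarrow> 'n \<Rightarrow> 'n \<Rightarrow> real" where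
  "g_inv g p c i j = matrix_inv (\<chi> k l. g p c [] [k, l]) $ i $ j"

text \<open>\<open>christoffel g p c i j k\<close> is the Christoffel symbol with upper index \<open>i\<close> and lower indices
  \<open>j\<close>, \<open>k\<close>.\<close>

definition christoffel ::
    "('a, 'n::finite) tensor_field \<Rightarrow> 'a \<Rightarrow> ('a, 'n) chart \<Rightarrow> 'n \<Rightarrow> 'n \<Rightarrow> 'n \<Rightarrow> real" where
  "christoffel g p c i j k = (1/2) * (\<Sum>l\<in>UNIV. g_inv g p c i l *
     (chart_partial c j (\<lambda>q. g q c [] [k, l]) p
    + chart_partial c k (\<lambda>q. g q c [] [j, l]) p
    - chart_partial c l (\<lambda>q. g q c [] [j, k]) p))"

text \<open>
  The covariant derivative takes tensors of type \<open>(r, s)\<close> to tensors of type \<open>(r, s + 1)\<close>.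
  The direction of differentiation is the first covariant index:
  \<open>nabla g T p c is (k # js)\<close> is the component of \<open>\<nabla>\<^sub>k T\<close> with indices \<open>is\<close>, \<open>js\<close>.
\<close>

definition nabla ::
    "('a, 'n::finite) tensor_field \<Rightarrow> ('a, 'n) tensor_field \<Rightarrow> ('a, 'n) tensor_field" where
  "nabla g T p c is js' = (case js' of [] \<Rightarrow> 0 | k # js \<Rightarrow>
     chart_partial c k (\<lambda>q. T q c is js) p
     + (\<Sum>a<length is. \<Sum>m\<in>UNIV. christoffel g p c (is ! a) k m * T p c (is[a := m]) js)
     - (\<Sum>b<length js. \<Sum>m\<in>UNIV. christoffel g p c m k (js ! b) * T p c is (js[b := m])))"

text \<open>
  \<open>riemann g p c i j k l\<close> is the component \<open>i\<close> of \<open>R(\<partial>\<^sub>k, \<partial>\<^sub>l)\<partial>\<^sub>j\<close>, where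
  \<open>R(X, Y)Z = \<nabla>\<^sub>X \<nabla>\<^sub>Y Z - \<nabla>\<^sub>Y \<nabla>\<^sub>X Z - \<nabla>\<^bsub>[X,Y]\<^esub> Z\<close>. With the trace taken in \<open>ricci\<close>, round spheres
  have positive Ricci curvature.
\<close>

definition riemann ::
    "('a, 'n::finite) tensor_field \<Rightarrow> 'a \<Rightarrow> ('a, 'n) chart \<Rightarrow> 'n \<Rightarrow> 'n \<Rightarrow> 'n \<Rightarrow> 'n \<Rightarrow> real" where
  "riemann g p c i j k l =
     chart_partial c k (\<lambda>q. christoffel g q c i l j) p
     - chart_partial c l (\<lambda>q. christoffel g q c i k j) p
     + (\<Sum>m\<in>UNIV. christoffel g p c i k m * christoffel g p c m l j
                 - christoffel g p c i l m * christoffel g p c m k j)"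

definition ricci ::
    "('a, 'n::finite) tensor_field \<Rightarrow> 'a \<Rightarrow> ('a, 'n) chart \<Rightarrow> 'n \<Rightarrow> 'n \<Rightarrow> real" where
  "ricci g p c j l = (\<Sum>i\<in>UNIV. riemann g p c i j i l)"

definition hessian ::
    "('a, 'n::finite) tensor_field \<Rightarrow> ('a \<Rightarrow> real) \<Rightarrow> 'a \<Rightarrow> ('a, 'n) chart \<Rightarrow> 'n \<Rightarrow> 'n \<Rightarrow> real" where
  "hessian g f p c i j = nabla g (nabla g (scalar f)) p c [] [i, j]"

definition gradient_ricci_soliton ::
    "'a topology \<Rightarrow> ('a, 'n::finite) chart set \<Rightarrow> ('a, 'n) tensor_field \<Rightarrow> ('a \<Rightarrow> real) \<Rightarrow> real \<Rightarrow> bool"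
  where
  "gradient_ricci_soliton M A g f \<kappa> \<longleftrightarrow>
     smooth_manifold M A \<and> riemannian_metric A g \<and> smooth_function A f \<and>
     (\<forall>c\<in>A. \<forall>p\<in>chart_dom c. \<forall>i j.
        ricci g p c i j + hessian g f p c i j = \<kappa> * g p c [] [i, j])"


section \<open>Weighted differential operators\<close>

text \<open>The gradient of a tensor of type \<open>(0, 0)\<close>, as a vector field.\<close>

definition grad ::
    "('a, 'n::finite) tensor_field \<Rightarrow> ('a, 'n) tensor_field \<Rightarrow> ('a, 'n) tensor_field" where
  "grad g u p c is js = (\<Sum>l\<in>UNIV. g_inv g p c (hd is) l * nabla g u p c [] [l])"

definition flat ::
    "('a, 'n::finite) tensor_field \<Rightarrow> ('a, 'n) tensor_field \<Rightarrow> ('a, 'n) tensor_field" where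
  "flat g V p c is js = (\<Sum>l\<in>UNIV. g p c [] [hd js, l] * V p c [l] [])"

definition sharp ::
    "('a, 'n::finite) tensor_field \<Rightarrow> ('a, 'n) tensor_field \<Rightarrow> ('a, 'n) tensor_field" where
  "sharp g \<omega> p c is js = (\<Sum>l\<in>UNIV. g_inv g p c (hd is) l * \<omega> p c [] [l])"

definition inner_field ::
    "('a, 'n::finite) tensor_field \<Rightarrow> ('a, 'n) tensor_field \<Rightarrow> ('a, 'n) tensor_field
      \<Rightarrow> ('a, 'n) tensor_field" where
  "inner_field g V W p c is js =
     (\<Sum>i\<in>UNIV. \<Sum>j\<in>UNIV. g p c [] [i, j] * V p c [i] [] * W p c [j] [])"

definition divergence ::
    "('a, 'n::finite) tensor_field \<Rightarrow> ('a, 'n) tensor_field \<Rightarrow> ('a, 'n) tensor_field" where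
  "divergence g V p c is js = (\<Sum>i\<in>UNIV. nabla g V p c [i] [i])"

text \<open>\<open>\<nabla>\<^sub>X T\<close>, for a vector field \<open>X\<close> and a tensor field \<open>T\<close> of any type.\<close>

definition nabla_dir ::
    "('a, 'n::finite) tensor_field \<Rightarrow> ('a, 'n) tensor_field \<Rightarrow> ('a, 'n) tensor_field
      \<Rightarrow> ('a, 'n) tensor_field" where
  "nabla_dir g X T p c is js = (\<Sum>k\<in>UNIV. X p c [k] [] * nabla g T p c is (k # js))"

definition laplacian ::
    "('a, 'n::finite) tensor_field \<Rightarrow> ('a, 'n) tensor_field \<Rightarrow> ('a, 'n) tensor_field" where
  "laplacian g T p c is js =
     (\<Sum>k\<in>UNIV. \<Sum>l\<in>UNIV. g_inv g p c k l * nabla g (nabla g T) p c is (k # l # js))"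

text \<open>The drift Laplacian, on tensor fields of any type.\<close>

definition drift_laplacian ::
    "('a, 'n::finite) tensor_field \<Rightarrow> ('a \<Rightarrow> real) \<Rightarrow> ('a, 'n) tensor_field \<Rightarrow> ('a, 'n) tensor_field"
  where
  "drift_laplacian g f T p c is js =
     laplacian g T p c is js - nabla_dir g (grad g (scalar f)) T p c is js"

definition div_f ::
    "('a, 'n::finite) tensor_field \<Rightarrow> ('a \<Rightarrow> real) \<Rightarrow> ('a, 'n) tensor_field \<Rightarrow> ('a, 'n) tensor_field"
  where
  "div_f g f V p c is js =
     divergence g V p c is js - inner_field g V (grad g (scalar f)) p c is js"

text \<open>
  On a symmetric 2-tensor, \<open>(div_f h)\<^sub>i = h\<^sub>i\<^sub>j\<^sub>,\<^sub>j - f\<^sub>j h\<^sub>i\<^sub>j\<close> in an orthonormal frame. In a general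
  frame the repeated index is contracted with the inverse metric, which gives a 1-form.
\<close>

definition div_f_sym_form ::
    "('a, 'n::finite) tensor_field \<Rightarrow> ('a \<Rightarrow> real) \<Rightarrow> ('a, 'n) tensor_field \<Rightarrow> ('a, 'n) tensor_field"
  where
  "div_f_sym_form g f h p c is js =
     (\<Sum>j\<in>UNIV. \<Sum>k\<in>UNIV. g_inv g p c j k *
        (nabla g h p c [] [k, hd js, j]
         - nabla g (scalar f) p c [] [k] * h p c [] [hd js, j]))"

definition div_f_sym ::
    "('a, 'n::finite) tensor_field \<Rightarrow> ('a \<Rightarrow> real) \<Rightarrow> ('a, 'n) tensor_field \<Rightarrow> ('a, 'n) tensor_field"
  where
  "div_f_sym g f h = sharp g (div_f_sym_form g f h)"

text \<open>The formal adjoint of \<open>div_f_sym\<close>; it does not depend on \<open>f\<close>.\<close>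

definition div_f_adj ::
    "('a, 'n::finite) tensor_field \<Rightarrow> ('a, 'n) tensor_field \<Rightarrow> ('a, 'n) tensor_field" where
  "div_f_adj g Y p c is js =
     - (1/2) * (nabla g (flat g Y) p c [] [js ! 0, js ! 1]
              + nabla g (flat g Y) p c [] [js ! 1, js ! 0])"

definition P_op ::
    "('a, 'n::finite) tensor_field \<Rightarrow> ('a \<Rightarrow> real) \<Rightarrow> ('a, 'n) tensor_field \<Rightarrow> ('a, 'n) tensor_field"
  where
  "P_op g f V = div_f_sym g f (div_f_adj g V)"

end

theory Submission
  imports Defs
begin

text \<open>
  All four vector fields in the theorem have, at a point of a chart, components that are built from
  the components of \<open>g\<close>, \<open>f\<close>, \<open>V\<close> and their derivatives in that same chart. The theorem is
  therefore an identity between smooth functions on the domain of one chart, and all computations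
  below are done there.

  Let \<open>T\<^sup>a\<^sup>b = g\<^sup>b\<^sup>k \<nabla>\<^sub>k V\<^sup>a\<close> be \<open>\<nabla>V\<close> with both indices raised. Its weighted divergence in the
  derivative index is \<open>\<L>V\<close>; let \<open>SV\<close> be the weighted divergence in the other index. Four facts
  carry the proof.

  \<^item> \<open>\<P>V = -(\<L>V + SV)/2\<close>, since \<open>div\<^sub>f\<^sup>*V\<close> is the negative symmetric part of \<open>T\<close>
    (\<open>P_op_eq\<close>).
  \<^item> \<open>SV = \<nabla> div\<^sub>f V + \<kappa>V\<close>: exchanging the two covariant derivatives in \<open>\<nabla>\<^sub>l \<nabla>\<^sub>i V\<^sup>l\<close> produces
    \<open>Ric\<close>, moving \<open>\<nabla>\<^sub>i\<close> past the factor \<open>\<nabla>f\<close> in \<open>div\<^sub>f V\<close> produces the Hessian of \<open>f\<close>, and the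
    soliton equation adds them up to \<open>\<kappa>g\<close> (\<open>drift_transpose_eq\<close>).
  \<^item> \<open>\<L>X = SX\<close> for a gradient field \<open>X\<close>, because \<open>T\<close> is then the symmetric Hessian
    (\<open>drift_laplacian_grad\<close>).
  \<^item> \<open>div\<^sub>f \<L>V = div\<^sub>f SV\<close>, because \<open>\<L>V - SV\<close> is the weighted divergence of the antisymmetric
    tensor \<open>T\<^sup>a\<^sup>b - T\<^sup>b\<^sup>a\<close>, and two weighted divergences annihilate an antisymmetric tensor
    (\<open>div_f_div_f_antisym\<close>).

  With \<open>X = \<nabla> div\<^sub>f V\<close> they give
  \<open>\<L>X = SX = \<nabla> div\<^sub>f X + \<kappa>X = \<nabla> div\<^sub>f (X + \<kappa>V) = \<nabla> div\<^sub>f SV = \<nabla> div\<^sub>f \<L>V\<close>,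
  that is, \<open>\<L>\<close> commutes with \<open>\<nabla> div\<^sub>f\<close> (\<open>drift_laplacian_grad_div_f\<close>). Since
  \<open>\<P> = -(\<L> + \<nabla> div\<^sub>f + \<kappa>)/2\<close> is a linear combination of these two operators and the identity,
  it commutes with both of them.
\<close>

section \<open>Calculus of smooth functions on open subsets of Euclidean space\<close>

text \<open>
  The derivative at a point of an open set \<open>S\<close> only sees values on \<open>S\<close>. This lets the rules for
  derivatives, which hold pointwise on \<open>S\<close>, be fed back into the recursion defining \<open>C_k_on\<close>.
\<close>

lemma C_k_on_cong:
  assumes "open S" "\<And>x. x \<in> S \<Longrightarrow> F x = G x" "C_k_on k S F"
  shows "C_k_on k S G"
  using assms(2,3)
proof (induction k arbitrary: F G)
  case 0
  then show ?case using continuous_on_cong[of S S F G] by simp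
next
  case (Suc k)
  have der: "(G has_derivative frechet_derivative F (at x)) (at x)" if "x \<in> S" for x
  proof (rule has_derivative_transform_within_open[OF _ \<open>open S\<close> that])
    show "(F has_derivative frechet_derivative F (at x)) (at x)"
      using Suc.prems(2) that by (simp add: frechet_derivative_works[symmetric])
  qed (rule Suc.prems(1))
  have "partial i F x = partial i G x" if "x \<in> S" for i x
    using frechet_derivative_at[OF der[OF that]] by (simp add: partial_def)
  then have "C_k_on k S (partial i G)" for i
    using Suc.IH Suc.prems(2) by (metis C_k_on.simps(2))
  then show ?case using der by (auto simp: differentiable_def)
qed

lemma C_k_on_SucD: "C_k_on (Suc k) S F \<Longrightarrow> C_k_on k S F"
proof (induction k arbitrary: F)
  case 0
  then show ?case
    by (auto intro!: continuous_at_imp_continuous_on differentiable_imp_continuous_within)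
next
  case (Suc k)
  then show ?case by (metis C_k_on.simps(2))
qed

lemma partial_add:
  assumes "F differentiable at x" "G differentiable at x"
  shows "partial i (\<lambda>x. F x + G x) x = partial i F x + partial i G x"
proof -
  have "((\<lambda>x. F x + G x) has_derivative
      (\<lambda>v. frechet_derivative F (at x) v + frechet_derivative G (at x) v)) (at x)"
    using assms by (intro has_derivative_add) (auto simp: frechet_derivative_works[symmetric])
  from frechet_derivative_at[OF this] show ?thesis
    by (simp add: partial_def fun_eq_iff)
qed

lemma partial_mult:
  assumes "F differentiable at x" "G differentiable at x"
  shows "partial i (\<lambda>x. F x * G x) x = F x * partial i G x + partial i F x * G x"
proof -
  have "((\<lambda>x. F x * G x) has_derivative
      (\<lambda>v. F x * frechet_derivative G (at x) v + frechet_derivative F (at x) v * G x)) (at x)"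
    using assms by (intro has_derivative_mult) (auto simp: frechet_derivative_works[symmetric])
  from frechet_derivative_at[OF this] show ?thesis
    by (simp add: partial_def fun_eq_iff)
qed

lemma partial_inverse:
  assumes "F differentiable at x" "F x \<noteq> 0"
  shows "partial i (\<lambda>x. inverse (F x)) x = - (inverse (F x) * partial i F x * inverse (F x))"
proof -
  have "((\<lambda>x. inverse (F x)) has_derivative
      (\<lambda>v. - (inverse (F x) * frechet_derivative F (at x) v * inverse (F x)))) (at x)"
    by (rule Deriv.has_derivative_inverse[where f=F, OF assms(2)])
      (use assms(1) in \<open>simp add: frechet_derivative_works[symmetric]\<close>)
  from frechet_derivative_at[OF this] show ?thesis
    by (simp add: partial_def fun_eq_iff)
qed

lemma partial_const: "partial i (\<lambda>x. a) = (\<lambda>x. 0)"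
  by (simp add: partial_def fun_eq_iff)

lemma C_k_on_const: "C_k_on k S (\<lambda>x. a)"
  by (induction k arbitrary: a) (auto simp: partial_const)

lemma C_k_on_add:
  assumes "open S" "C_k_on k S F" "C_k_on k S G"
  shows "C_k_on k S (\<lambda>x. F x + G x)"
  using assms(2,3)
proof (induction k arbitrary: F G)
  case 0
  then show ?case by (auto intro: continuous_intros)
next
  case (Suc k)
  have "C_k_on k S (\<lambda>x. partial i F x + partial i G x)" for i
    using Suc by simp
  then have "C_k_on k S (partial i (\<lambda>x. F x + G x))" for i
    by (rule C_k_on_cong[OF \<open>open S\<close>, rotated]) (use Suc.prems in \<open>simp add: partial_add\<close>)
  then show ?case using Suc.prems by (auto intro: derivative_intros)
qed

text \<open>
  In the product rule one factor of each summand is not differentiated; \<open>C_k_on_SucD\<close> brings it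
  down to the order of the other one.
\<close>

lemma C_k_on_mult:
  assumes "open S" "C_k_on k S F" "C_k_on k S G"
  shows "C_k_on k S (\<lambda>x. F x * G x)"
  using assms(2,3)
proof (induction k arbitrary: F G)
  case 0
  then show ?case by (auto intro: continuous_intros)
next
  case (Suc k)
  have "C_k_on k S (\<lambda>x. F x * partial i G x + partial i F x * G x)" for i
    using Suc.prems C_k_on_SucD
    by (intro C_k_on_add[OF \<open>open S\<close>] Suc.IH) (blast, simp, simp, blast)
  then have "C_k_on k S (partial i (\<lambda>x. F x * G x))" for i
    by (rule C_k_on_cong[OF \<open>open S\<close>, rotated]) (use Suc.prems in \<open>simp add: partial_mult\<close>)
  then show ?case using Suc.prems by (auto intro: derivative_intros)
qed

lemma C_k_on_inverse:
  assumes "open S" "\<And>x. x \<in> S \<Longrightarrow> F x \<noteq> 0" "C_k_on k S F"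
  shows "C_k_on k S (\<lambda>x. inverse (F x))"
  using assms(3)
proof (induction k)
  case 0
  then show ?case using assms(2) by (auto intro!: continuous_intros)
next
  case (Suc k)
  have "C_k_on k S (\<lambda>x. (- 1) * (inverse (F x) * partial i F x * inverse (F x)))" for i
    using Suc C_k_on_SucD[OF Suc.prems]
    by (intro C_k_on_mult[OF \<open>open S\<close>] C_k_on_const) auto
  then have "C_k_on k S (partial i (\<lambda>x. inverse (F x)))" for i
    by (rule C_k_on_cong[OF \<open>open S\<close>, rotated]) (use Suc.prems assms(2) in \<open>simp add: partial_inverse\<close>)
  then show ?case using Suc.prems assms(2) by (auto intro!: derivative_intros)
qed

lemma has_real_derivative_partial:
  assumes "F differentiable at (y + s *\<^sub>R axis i 1)"
  shows "((\<lambda>s. F (y + s *\<^sub>R axis i 1)) has_real_derivative partial i F (y + s *\<^sub>R axis i 1)) (at s)"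
proof -
  let ?D = "frechet_derivative F (at (y + s *\<^sub>R axis i 1))"
  have D: "(F has_derivative ?D) (at (y + s *\<^sub>R axis i 1))"
    using assms by (simp add: frechet_derivative_works)
  have "((\<lambda>s. y + s *\<^sub>R axis i 1) has_derivative (\<lambda>t. t *\<^sub>R axis i 1)) (at s)"
    by (auto intro!: derivative_eq_intros)
  then have "((\<lambda>s. F (y + s *\<^sub>R axis i 1)) has_derivative (\<lambda>t. ?D (t *\<^sub>R axis i 1))) (at s)"
    using has_derivative_compose D by blast
  moreover have "?D (t *\<^sub>R axis i 1) = partial i F (y + s *\<^sub>R axis i 1) * t" for t
    using linear_scale[OF linear_frechet_derivative[OF assms]] by (simp add: partial_def)
  ultimately show ?thesis by (simp add: has_field_derivative_def)
qed

text \<open>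
  The mean value theorem, applied first in direction \<open>i\<close> to the difference of \<open>F\<close> along direction
  \<open>j\<close>, and then in direction \<open>j\<close> to the resulting difference of \<open>partial i F\<close>.
\<close>

lemma second_difference_eq_mixed_partial:
  assumes "C_k_on 2 S F" "h > 0"
    and "\<And>s t. 0 \<le> s \<Longrightarrow> s \<le> h \<Longrightarrow> 0 \<le> t \<Longrightarrow> t \<le> h \<Longrightarrow> x + s *\<^sub>R axis i 1 + t *\<^sub>R axis j 1 \<in> S"
  shows "\<exists>s t. 0 < s \<and> s < h \<and> 0 < t \<and> t < h \<and>
      F (x + h *\<^sub>R axis i 1 + h *\<^sub>R axis j 1) - F (x + h *\<^sub>R axis i 1) - F (x + h *\<^sub>R axis j 1) + F x
      = h * h * partial j (partial i F) (x + s *\<^sub>R axis i 1 + t *\<^sub>R axis j 1)"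
proof -
  let ?e = "axis i (1::real)" and ?e' = "axis j (1::real)"
  have dF: "F differentiable at y" and dpF: "partial i F differentiable at y" if "y \<in> S" for y
    using that assms(1) by (auto simp: numeral_2_eq_2)
  define G where "G s = F (x + h *\<^sub>R ?e' + s *\<^sub>R ?e) - F (x + s *\<^sub>R ?e)" for s
  have "(G has_real_derivative
      (partial i F (x + h *\<^sub>R ?e' + s *\<^sub>R ?e) - partial i F (x + s *\<^sub>R ?e))) (at s)"
    if "0 \<le> s" "s \<le> h" for s
    unfolding G_def using assms(3)[of s h] assms(3)[of s 0] that \<open>h > 0\<close>
    by (intro derivative_intros has_real_derivative_partial dF) (auto simp: algebra_simps)
  from MVT2[OF \<open>h > 0\<close> this] obtain s where s: "0 < s" "s < h"
    and Gs: "G h - G 0 = (h - 0) * (partial i F (x + h *\<^sub>R ?e' + s *\<^sub>R ?e) - partial i F (x + s *\<^sub>R ?e))"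
    by blast
  have "((\<lambda>t. partial i F (x + s *\<^sub>R ?e + t *\<^sub>R ?e')) has_real_derivative
      partial j (partial i F) (x + s *\<^sub>R ?e + t *\<^sub>R ?e')) (at t)" if "0 \<le> t" "t \<le> h" for t
    using assms(3)[of s t] that s
    by (intro has_real_derivative_partial dpF) auto
  from MVT2[OF \<open>h > 0\<close> this] obtain t where t: "0 < t" "t < h"
    and "partial i F (x + s *\<^sub>R ?e + h *\<^sub>R ?e') - partial i F (x + s *\<^sub>R ?e)
      = h * partial j (partial i F) (x + s *\<^sub>R ?e + t *\<^sub>R ?e')"
    by auto
  with Gs have "G h - G 0 = h * h * partial j (partial i F) (x + s *\<^sub>R ?e + t *\<^sub>R ?e')"
    by (simp add: algebra_simps)
  then show ?thesis using s t unfolding G_def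
    by (intro exI[of _ s] exI[of _ t]) (simp add: algebra_simps)
qed

text \<open>
  The second difference over a square with corner \<open>x\<close> is symmetric in the two directions, so it
  expresses a value of either mixed derivative close to \<open>x\<close>. Shrinking the square, continuity of both
  mixed derivatives makes their values at \<open>x\<close> agree.
\<close>

lemma partial_commute:
  assumes "open S" "C_k_on 2 S F" "x \<in> S"
  shows "partial i (partial j F) x = partial j (partial i F) x"
proof (rule ccontr)
  let ?a = "partial i (partial j F)" and ?b = "partial j (partial i F)"
  assume neq: "?a x \<noteq> ?b x"
  define e where "e = \<bar>?a x - ?b x\<bar> / 2"
  have "e > 0" using neq by (simp add: e_def)
  have cont: "isCont ?a x" "isCont ?b x"
    using assms by (auto simp: numeral_2_eq_2 continuous_on_eq_continuous_at)
  obtain d1 where d1: "d1 > 0" "\<And>y. dist y x < d1 \<Longrightarrow> dist (?a y) (?a x) < e"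
    using cont(1) \<open>e > 0\<close> unfolding continuous_at_eps_delta by blast
  obtain d2 where d2: "d2 > 0" "\<And>y. dist y x < d2 \<Longrightarrow> dist (?b y) (?b x) < e"
    using cont(2) \<open>e > 0\<close> unfolding continuous_at_eps_delta by blast
  obtain d3 where d3: "d3 > 0" "\<And>y. dist y x < d3 \<Longrightarrow> y \<in> S"
    using assms(1,3) unfolding open_dist by blast
  \<comment> \<open>Points of a square of side \<open>h\<close> have distance at most \<open>2 * h\<close> from its corner.\<close>
  define h where "h = min d1 (min d2 d3) / 3"
  have h: "h > 0" "3 * h \<le> d1" "3 * h \<le> d2" "3 * h \<le> d3"
    using d1 d2 d3 by (auto simp: h_def)
  have near: "dist (x + s *\<^sub>R axis k 1 + t *\<^sub>R axis l 1) x < 3 * h"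
    if "0 \<le> s" "s \<le> h" "0 \<le> t" "t \<le> h" for s t :: real and k l
  proof -
    have "norm (s *\<^sub>R axis k (1::real) + t *\<^sub>R axis l 1)
        \<le> norm (s *\<^sub>R axis k (1::real)) + norm (t *\<^sub>R axis l (1::real))"
      by (rule norm_triangle_ineq)
    also have "\<dots> \<le> h + h" using that by (simp add: norm_axis_1)
    finally show ?thesis using h by (simp add: dist_norm algebra_simps)
  qed
  have inS: "x + s *\<^sub>R axis k 1 + t *\<^sub>R axis l 1 \<in> S"
    if "0 \<le> s" "s \<le> h" "0 \<le> t" "t \<le> h" for s t :: real and k l
    using near[OF that, of k l] h d3(2) by simp
  obtain s t where st: "0 < s" "s < h" "0 < t" "t < h"
    "F (x + h *\<^sub>R axis i 1 + h *\<^sub>R axis j 1) - F (x + h *\<^sub>R axis i 1) - F (x + h *\<^sub>R axis j 1) + F x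
      = h * h * ?b (x + s *\<^sub>R axis i 1 + t *\<^sub>R axis j 1)"
    using second_difference_eq_mixed_partial[OF assms(2) h(1) inS, of i j] by blast
  obtain s' t' where st': "0 < s'" "s' < h" "0 < t'" "t' < h"
    "F (x + h *\<^sub>R axis j 1 + h *\<^sub>R axis i 1) - F (x + h *\<^sub>R axis j 1) - F (x + h *\<^sub>R axis i 1) + F x
      = h * h * ?a (x + s' *\<^sub>R axis j 1 + t' *\<^sub>R axis i 1)"
    using second_difference_eq_mixed_partial[OF assms(2) h(1) inS, of j i] by blast
  let ?y = "x + s *\<^sub>R axis i 1 + t *\<^sub>R axis j 1" and ?z = "x + s' *\<^sub>R axis j 1 + t' *\<^sub>R axis i 1"
  have "h * h * ?b ?y = h * h * ?a ?z"
    unfolding st(5)[symmetric] st'(5)[symmetric] by (simp add: add.commute add.left_commute)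
  then have eq: "?b ?y = ?a ?z" using h(1) by simp
  have "dist (?b ?y) (?b x) < e"
    using near[of s t i j] st h by (intro d2(2)) linarith
  moreover have "dist (?a ?z) (?a x) < e"
    using near[of s' t' j i] st' h by (intro d1(2)) linarith
  ultimately show False
    using eq abs_triangle_ineq4[of "?a x - ?a ?z" "?b x - ?b ?y"]
    by (simp add: e_def dist_real_def abs_minus_commute)
qed

section \<open>Partial derivatives in a coordinate chart\<close>

definition chart_smooth :: "('a, 'n::finite) chart \<Rightarrow> ('a \<Rightarrow> real) \<Rightarrow> bool" where
  "chart_smooth c u \<longleftrightarrow> smooth_on (chart_map c ` chart_dom c) (\<lambda>x. u (chart_inv c x))"

locale coordinate_chart =
  fixes c :: "('a, 'n::finite) chart"
  assumes open_image: "open (chart_map c ` chart_dom c)"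
    and inj: "inj_on (chart_map c) (chart_dom c)"
begin

abbreviation "U \<equiv> chart_dom c"
abbreviation "\<Omega> \<equiv> chart_map c ` chart_dom c"
abbreviation "D \<equiv> chart_partial c"

lemma chart_inv_chart_map [simp]: "p \<in> U \<Longrightarrow> chart_inv c (chart_map c p) = p"
  by (simp add: the_inv_into_f_f inj)

lemma chart_smooth_cong:
  assumes "\<And>q. q \<in> U \<Longrightarrow> u q = v q" "chart_smooth c u"
  shows "chart_smooth c v"
proof -
  have "C_k_on k \<Omega> (\<lambda>x. v (chart_inv c x))" for k
    by (rule C_k_on_cong[OF open_image, of "\<lambda>x. u (chart_inv c x)"])
      (use assms in \<open>auto simp: chart_smooth_def smooth_on_def\<close>)
  then show ?thesis by (simp add: chart_smooth_def smooth_on_def)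
qed

lemma differentiable_chart_smooth:
  assumes "chart_smooth c u" "p \<in> U"
  shows "(\<lambda>x. u (chart_inv c x)) differentiable at (chart_map c p)"
proof -
  have "C_k_on (Suc 0) \<Omega> (\<lambda>x. u (chart_inv c x))"
    using assms(1) unfolding chart_smooth_def smooth_on_def by blast
  then show ?thesis using assms(2) by simp
qed

lemma chart_smooth_const: "chart_smooth c (\<lambda>q. a)"
  by (simp add: chart_smooth_def smooth_on_def C_k_on_const)

lemma chart_smooth_add:
  "chart_smooth c u \<Longrightarrow> chart_smooth c v \<Longrightarrow> chart_smooth c (\<lambda>q. u q + v q)"
  by (simp add: chart_smooth_def smooth_on_def C_k_on_add open_image)

lemma chart_smooth_mult:
  "chart_smooth c u \<Longrightarrow> chart_smooth c v \<Longrightarrow> chart_smooth c (\<lambda>q. u q * v q)"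
  by (simp add: chart_smooth_def smooth_on_def C_k_on_mult open_image)

lemma chart_smooth_minus: "chart_smooth c u \<Longrightarrow> chart_smooth c (\<lambda>q. - u q)"
  using chart_smooth_mult[OF chart_smooth_const[of "-1"], of u] by simp

lemma chart_smooth_diff:
  "chart_smooth c u \<Longrightarrow> chart_smooth c v \<Longrightarrow> chart_smooth c (\<lambda>q. u q - v q)"
  using chart_smooth_add[OF _ chart_smooth_minus, of u v] by simp

lemma chart_smooth_sum:
  "(\<And>i. i \<in> I \<Longrightarrow> chart_smooth c (u i)) \<Longrightarrow> chart_smooth c (\<lambda>q. \<Sum>i\<in>I. u i q)"
  by (induction I rule: infinite_finite_induct) (auto intro: chart_smooth_const chart_smooth_add)

lemma chart_smooth_prod:
  "(\<And>i. i \<in> I \<Longrightarrow> chart_smooth c (u i)) \<Longrightarrow> chart_smooth c (\<lambda>q. \<Prod>i\<in>I. u i q)"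
  by (induction I rule: infinite_finite_induct) (auto intro: chart_smooth_const chart_smooth_mult)

lemma chart_smooth_divide:
  assumes "\<And>q. q \<in> U \<Longrightarrow> v q \<noteq> 0" "chart_smooth c u" "chart_smooth c v"
  shows "chart_smooth c (\<lambda>q. u q / v q)"
proof -
  have "chart_smooth c (\<lambda>q. inverse (v q))"
    unfolding chart_smooth_def smooth_on_def
    by (intro allI C_k_on_inverse[OF open_image])
      (use assms(1,3) in \<open>auto simp: chart_smooth_def smooth_on_def\<close>)
  then show ?thesis using chart_smooth_mult[OF assms(2)] by (simp add: divide_inverse)
qed

lemma chart_smooth_D:
  assumes "chart_smooth c u"
  shows "chart_smooth c (D k u)"
proof -
  have "C_k_on n \<Omega> (partial k (\<lambda>x. u (chart_inv c x)))" for n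
    using assms unfolding chart_smooth_def smooth_on_def by (metis C_k_on.simps(2))
  moreover have "D k u (chart_inv c x) = partial k (\<lambda>x. u (chart_inv c x)) x" if "x \<in> \<Omega>" for x
    using that by (auto simp: chart_partial_def)
  ultimately show ?thesis
    unfolding chart_smooth_def smooth_on_def
    using C_k_on_cong[OF open_image, of "partial k (\<lambda>x. u (chart_inv c x))"] by metis
qed

lemmas smooth_rules = chart_smooth_const chart_smooth_add chart_smooth_mult chart_smooth_minus
  chart_smooth_diff chart_smooth_sum chart_smooth_D

text \<open>
  Components outside the chart domain are arbitrary, so tensor identities hold on \<open>U\<close> only. They may
  nevertheless be differentiated at points of the open set \<open>U\<close>.
\<close>

lemma D_cong:
  assumes "p \<in> U" "\<And>q. q \<in> U \<Longrightarrow> u q = v q"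
  shows "D k u p = D k v p"
proof -
  let ?F = "\<lambda>x. u (chart_inv c x)" and ?G = "\<lambda>x. v (chart_inv c x)" and ?x = "chart_map c p"
  have eq: "?F x = ?G x" if "x \<in> \<Omega>" for x using that assms(2) by auto
  have "(?F has_derivative d) (at ?x) \<longleftrightarrow> (?G has_derivative d) (at ?x)" for d
    using assms(1) eq has_derivative_transform_within_open[OF _ open_image, of ?F d ?x UNIV ?G]
      has_derivative_transform_within_open[OF _ open_image, of ?G d ?x UNIV ?F]
    by (metis imageI)
  then show ?thesis by (simp add: chart_partial_def partial_def frechet_derivative_def)
qed

lemma D_const: "D k (\<lambda>q. a) p = 0"
  by (simp add: chart_partial_def partial_const)

lemma D_add:
  "p \<in> U \<Longrightarrow> chart_smooth c u \<Longrightarrow> chart_smooth c v \<Longrightarrow>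
    D k (\<lambda>q. u q + v q) p = D k u p + D k v p"
  by (simp add: chart_partial_def partial_add differentiable_chart_smooth)

lemma D_mult:
  "p \<in> U \<Longrightarrow> chart_smooth c u \<Longrightarrow> chart_smooth c v \<Longrightarrow>
    D k (\<lambda>q. u q * v q) p = u p * D k v p + D k u p * v p"
  by (simp add: chart_partial_def partial_mult differentiable_chart_smooth)

lemma D_cmult: "p \<in> U \<Longrightarrow> chart_smooth c u \<Longrightarrow> D k (\<lambda>q. a * u q) p = a * D k u p"
  by (simp add: D_mult D_const chart_smooth_const)

lemma D_minus: "p \<in> U \<Longrightarrow> chart_smooth c u \<Longrightarrow> D k (\<lambda>q. - u q) p = - D k u p"
  using D_cmult[of p u k "-1"] by simp

lemma D_diff:
  "p \<in> U \<Longrightarrow> chart_smooth c u \<Longrightarrow> chart_smooth c v \<Longrightarrow>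
    D k (\<lambda>q. u q - v q) p = D k u p - D k v p"
  using D_add[of p u "\<lambda>q. - v q" k] by (simp add: D_minus chart_smooth_minus)

lemma D_sum:
  assumes "p \<in> U" "\<And>i. i \<in> I \<Longrightarrow> chart_smooth c (u i)"
  shows "D k (\<lambda>q. \<Sum>i\<in>I. u i q) p = (\<Sum>i\<in>I. D k (u i) p)"
  using assms(2)
  by (induction I rule: infinite_finite_induct)
    (auto simp: D_const D_add \<open>p \<in> U\<close> chart_smooth_sum)

lemmas D_rules = D_const D_add D_cmult D_mult D_minus D_diff D_sum

lemma D_commute:
  assumes "p \<in> U" "chart_smooth c u"
  shows "D i (D j u) p = D j (D i u) p"
proof -
  let ?F = "\<lambda>x. u (chart_inv c x)"
  have DD: "D i (D j u) p = partial i (partial j ?F) (chart_map c p)" for i j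
  proof -
    have "C_k_on (Suc 0) \<Omega> (partial j ?F)"
      using assms(2) unfolding chart_smooth_def smooth_on_def by (metis C_k_on.simps(2))
    then have "partial j ?F differentiable at (chart_map c p)" using assms(1) by simp
    then have "(partial j ?F has_derivative
        frechet_derivative (partial j ?F) (at (chart_map c p))) (at (chart_map c p))"
      by (simp add: frechet_derivative_works[symmetric])
    then have "((\<lambda>x. D j u (chart_inv c x)) has_derivative
        frechet_derivative (partial j ?F) (at (chart_map c p))) (at (chart_map c p))"
      by (rule has_derivative_transform_within_open[OF _ open_image])
        (use assms(1) in \<open>auto simp: chart_partial_def\<close>)
    from frechet_derivative_at[OF this] show ?thesis
      by (simp add: chart_partial_def[of c i] partial_def[of i])
  qed
  have "C_k_on 2 \<Omega> ?F" using assms(2) unfolding chart_smooth_def smooth_on_def by blast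
  from partial_commute[OF open_image this] show ?thesis using assms(1) by (simp add: DD)
qed

end

section \<open>The metric and its Christoffel symbols\<close>

locale metric_chart = coordinate_chart c for c :: "('a, 'n::finite) chart" +
  fixes g :: "('a, 'n) tensor_field"
  assumes smooth_metric: "chart_smooth c (\<lambda>q. g q c [] [i, j])"
    and metric_sym: "p \<in> U \<Longrightarrow> g p c [] [i, j] = g p c [] [j, i]"
    and metric_pos: "p \<in> U \<Longrightarrow> v \<noteq> 0 \<Longrightarrow>
      (\<Sum>i\<in>UNIV. \<Sum>j\<in>UNIV. g p c [] [i, j] * v $ i * v $ j) > (0::real)"
begin

text \<open>
  \<open>G\<close> and \<open>H\<close> are the components \<open>g\<^sub>i\<^sub>j\<close> and \<open>g\<^sup>i\<^sup>j\<close>. The point comes last, so that all components are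
  functions on the manifold to which \<open>D\<close> applies.
\<close>

abbreviation "G i j p \<equiv> g p c [] [i, j]"
abbreviation "H i j p \<equiv> g_inv g p c i j"
abbreviation "\<Gamma> i j k p \<equiv> christoffel g p c i j k"

lemma metric_invertible:
  assumes "p \<in> U"
  shows "invertible (\<chi> i j. G i j p)"
  unfolding invertible_left_inverse matrix_left_invertible_ker
proof (intro allI impI)
  fix v :: "real^'n"
  assume "(\<chi> i j. G i j p) *v v = 0"
  then have "(\<Sum>j\<in>UNIV. G i j p * v $ j) = 0" for i
    by (simp add: matrix_vector_mult_def vec_eq_iff)
  then have "(\<Sum>i\<in>UNIV. v $ i * (\<Sum>j\<in>UNIV. G i j p * v $ j)) = 0" by simp
  then have "(\<Sum>i\<in>UNIV. \<Sum>j\<in>UNIV. G i j p * v $ i * v $ j) = 0"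
    by (simp add: sum_distrib_left mult_ac)
  then show "v = 0" using metric_pos[OF assms, of v] by fastforce
qed

lemma matrix_inv_metric:
  assumes "p \<in> U"
  shows "(\<chi> i j. G i j p) ** matrix_inv (\<chi> i j. G i j p) = mat 1"
    and "matrix_inv (\<chi> i j. G i j p) ** (\<chi> i j. G i j p) = mat 1"
  using metric_invertible[OF assms]
    someI_ex[of "\<lambda>B. (\<chi> i j. G i j p) ** B = mat 1 \<and> B ** (\<chi> i j. G i j p) = mat 1"]
  unfolding invertible_def matrix_inv_def by blast+

lemma inverse_metric:
  assumes "p \<in> U"
  shows "(\<Sum>k\<in>UNIV. H i k p * G k j p) = (if i = j then 1 else 0)"
    and "(\<Sum>k\<in>UNIV. G i k p * H k j p) = (if i = j then 1 else 0)"
    and "H i j p = H j i p"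
proof -
  let ?A = "\<chi> i j. G i j p"
  have l: "matrix_inv ?A ** ?A = mat 1" and r: "?A ** matrix_inv ?A = mat 1"
    using matrix_inv_metric[OF assms] by auto
  show "(\<Sum>k\<in>UNIV. H i k p * G k j p) = (if i = j then 1 else 0)"
    using arg_cong[OF l, of "\<lambda>B. B $ i $ j"]
    by (simp add: matrix_matrix_mult_def mat_def g_inv_def)
  show "(\<Sum>k\<in>UNIV. G i k p * H k j p) = (if i = j then 1 else 0)"
    using arg_cong[OF r, of "\<lambda>B. B $ i $ j"]
    by (simp add: matrix_matrix_mult_def mat_def g_inv_def)
  have "transpose ?A = ?A" using metric_sym[OF assms] by (simp add: transpose_def vec_eq_iff)
  then have "transpose (matrix_inv ?A) ** ?A = mat 1"
    using arg_cong[OF r, of transpose] by (simp add: matrix_transpose_mul)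
  then have "(transpose (matrix_inv ?A) ** ?A) ** matrix_inv ?A = matrix_inv ?A"
    by simp
  then have "transpose (matrix_inv ?A) = matrix_inv ?A"
    by (simp add: matrix_mul_assoc[symmetric] r)
  then have "transpose (matrix_inv ?A) $ j $ i = matrix_inv ?A $ j $ i" by simp
  then show "H i j p = H j i p" by (simp add: transpose_def g_inv_def)
qed

text \<open>
  Cramer's rule expresses \<open>g\<^sup>i\<^sup>j\<close> as a quotient of two determinants, which are polynomials in the
  components of \<open>g\<close>.
\<close>

lemma smooth_inverse_metric: "chart_smooth c (\<lambda>q. H i j q)"
proof -
  let ?A = "\<lambda>q. \<chi> i j. G i j q"
  let ?B = "\<lambda>q. \<chi> k l. if l = i then axis j 1 $ k else G k l q"
  have "det (?B q) / det (?A q) = H i j q" if "q \<in> U" for q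
  proof -
    have "?A q *v (matrix_inv (?A q) *v axis j 1) = axis j 1"
      by (simp add: matrix_vector_mul_assoc matrix_inv_metric(1)[OF that])
    moreover have "det (?A q) \<noteq> 0" using metric_invertible[OF that] invertible_det_nz by blast
    ultimately have "matrix_inv (?A q) *v axis j 1 =
        (\<chi> i. det (\<chi> k l. if l = i then axis j 1 $ k else ?A q $ k $ l) / det (?A q))"
      using cramer by blast
    then have "(matrix_inv (?A q) *v axis j 1) $ i = det (?B q) / det (?A q)"
      by (simp cong: if_cong)
    then show ?thesis by (simp add: matrix_vector_mult_basis column_def g_inv_def)
  qed
  moreover have "chart_smooth c (\<lambda>q. det (?B q) / det (?A q))"
  proof (rule chart_smooth_divide)
    show "det (?A q) \<noteq> 0" if "q \<in> U" for q
      using metric_invertible[OF that] invertible_det_nz by blast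
    have B: "chart_smooth c (\<lambda>q. if l then a else G k m q)" for l a k m
      by (cases l) (auto intro: smooth_metric chart_smooth_const)
    show "chart_smooth c (\<lambda>q. det (?B q))" "chart_smooth c (\<lambda>q. det (?A q))"
      unfolding det_def
      by (auto intro!: chart_smooth_sum chart_smooth_mult chart_smooth_const chart_smooth_prod
          smooth_metric B)
  qed
  ultimately show ?thesis by (rule chart_smooth_cong)
qed

lemma smooth_christoffel: "chart_smooth c (\<lambda>q. \<Gamma> i j k q)"
  unfolding christoffel_def by (intro smooth_rules smooth_metric smooth_inverse_metric)

lemmas smooth_geometry = smooth_metric smooth_inverse_metric smooth_christoffel

lemma D_metric_sym:
  assumes "p \<in> U"
  shows "D k (\<lambda>q. G i j q) p = D k (\<lambda>q. G j i q) p"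
  by (rule D_cong[OF assms]) (rule metric_sym)

lemma christoffel_sym:
  assumes "p \<in> U"
  shows "\<Gamma> i j k p = \<Gamma> i k j p"
  using D_metric_sym[OF assms, of _ j k] by (simp add: christoffel_def algebra_simps)

text \<open>
  Stated for an arbitrary family \<open>X\<close>, so that it cancels a metric against its inverse inside larger
  contractions.
\<close>

lemma lower_raise:
  assumes "p \<in> U"
  shows "(\<Sum>m\<in>UNIV. G i m p * (\<Sum>l\<in>UNIV. H m l p * X l)) = X i"
proof -
  have "(\<Sum>m\<in>UNIV. G i m p * (\<Sum>l\<in>UNIV. H m l p * X l))
      = (\<Sum>m\<in>UNIV. \<Sum>l\<in>UNIV. G i m p * H m l p * X l)"
    by (simp add: sum_distrib_left mult.assoc)
  also have "\<dots> = (\<Sum>l\<in>UNIV. (\<Sum>m\<in>UNIV. G i m p * H m l p) * X l)"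
    by (subst sum.swap) (simp add: sum_distrib_right)
  also have "\<dots> = X i" by (simp add: inverse_metric(2)[OF assms] if_distrib[of "\<lambda>x. x * _"] cong: if_cong)
  finally show ?thesis .
qed

lemma raise_lower:
  assumes "p \<in> U"
  shows "(\<Sum>m\<in>UNIV. H i m p * (\<Sum>l\<in>UNIV. G m l p * X l)) = X i"
proof -
  have "(\<Sum>m\<in>UNIV. H i m p * (\<Sum>l\<in>UNIV. G m l p * X l))
      = (\<Sum>m\<in>UNIV. \<Sum>l\<in>UNIV. H i m p * G m l p * X l)"
    by (simp add: sum_distrib_left mult.assoc)
  also have "\<dots> = (\<Sum>l\<in>UNIV. (\<Sum>m\<in>UNIV. H i m p * G m l p) * X l)"
    by (subst sum.swap) (simp add: sum_distrib_right)
  also have "\<dots> = X i" by (simp add: inverse_metric(1)[OF assms] if_distrib[of "\<lambda>x. x * _"] cong: if_cong)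
  finally show ?thesis .
qed

lemma lowered_christoffel:
  assumes "p \<in> U"
  shows "(\<Sum>m\<in>UNIV. \<Gamma> m j k p * G m i p) =
    (D j (\<lambda>q. G k i q) p + D k (\<lambda>q. G j i q) p - D i (\<lambda>q. G j k q) p) / 2"
proof -
  have "(\<Sum>m\<in>UNIV. \<Gamma> m j k p * G m i p) = (1/2) * (\<Sum>m\<in>UNIV. G i m p * (\<Sum>l\<in>UNIV. H m l p *
      (D j (\<lambda>q. G k l q) p + D k (\<lambda>q. G j l q) p - D l (\<lambda>q. G j k q) p)))"
    using metric_sym[OF assms, of i] by (simp add: christoffel_def sum_distrib_left mult_ac)
  also have "\<dots> = (1/2) * (D j (\<lambda>q. G k i q) p + D k (\<lambda>q. G j i q) p - D i (\<lambda>q. G j k q) p)"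
    unfolding lower_raise[OF assms] ..
  finally show ?thesis by simp
qed

text \<open>
  This is \<open>\<nabla>g = 0\<close>: the two lowered Christoffel symbols add up so that all derivatives of \<open>g\<close> cancel
  except \<open>\<partial>\<^sub>k g\<^sub>i\<^sub>j\<close>.
\<close>

lemma D_metric:
  assumes "p \<in> U"
  shows "D k (\<lambda>q. G i j q) p =
    (\<Sum>m\<in>UNIV. \<Gamma> m k i p * G m j p) + (\<Sum>m\<in>UNIV. \<Gamma> m k j p * G m i p)"
  using D_metric_sym[OF assms, of k i j]
  by (simp add: lowered_christoffel[OF assms] field_simps)

text \<open>
  The rule \<open>\<partial>(g\<^sup>-\<^sup>1) = - g\<^sup>-\<^sup>1 (\<partial>g) g\<^sup>-\<^sup>1\<close>, from differentiating \<open>g\<^sup>-\<^sup>1 g = 1\<close>.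
\<close>

lemma D_inverse_metric_sandwich:
  assumes p: "p \<in> U"
  shows "D k (\<lambda>q. H i j q) p = - (\<Sum>l\<in>UNIV. H j l p * (\<Sum>m\<in>UNIV. H i m p * D k (\<lambda>q. G m l q) p))"
proof -
  have "D k (\<lambda>q. \<Sum>m\<in>UNIV. H i m q * G m l q) p = D k (\<lambda>q. if i = l then 1 else 0) p" for l
    by (rule D_cong[OF p]) (rule inverse_metric(1))
  then have "(\<Sum>m\<in>UNIV. H i m p * D k (\<lambda>q. G m l q) p + D k (\<lambda>q. H i m q) p * G m l p) = 0" for l
    by (simp add: D_rules smooth_rules smooth_geometry p)
  then have "(\<Sum>m\<in>UNIV. H i m p * D k (\<lambda>q. G m l q) p) = - (\<Sum>m\<in>UNIV. G l m p * D k (\<lambda>q. H i m q) p)" for l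
    by (simp add: sum.distrib metric_sym[OF p, of l] mult.commute add_eq_0_iff)
  then show ?thesis
    by (simp add: sum_negf raise_lower[OF p])
qed

text \<open>
  This is \<open>\<nabla>g\<^sup>-\<^sup>1 = 0\<close>, obtained by inserting \<open>\<nabla>g = 0\<close> into the previous formula.
\<close>

lemma D_inverse_metric:
  assumes p: "p \<in> U"
  shows "D k (\<lambda>q. H i j q) p =
    - (\<Sum>m\<in>UNIV. \<Gamma> i k m p * H m j p) - (\<Sum>m\<in>UNIV. \<Gamma> j k m p * H m i p)"
proof -
  have sym: "H i j p = H j i p" for i j by (rule inverse_metric(3)[OF p])
  have "(\<Sum>m\<in>UNIV. H i m p * D k (\<lambda>q. G m l q) p)
      = (\<Sum>n\<in>UNIV. G l n p * (\<Sum>m\<in>UNIV. \<Gamma> n k m p * H m i p)) + \<Gamma> i k l p" for l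
  proof -
    have "(\<Sum>m\<in>UNIV. H i m p * D k (\<lambda>q. G m l q) p)
        = (\<Sum>m\<in>UNIV. H i m p * (\<Sum>n\<in>UNIV. \<Gamma> n k m p * G n l p))
        + (\<Sum>m\<in>UNIV. H i m p * (\<Sum>n\<in>UNIV. G m n p * \<Gamma> n k l p))"
      using metric_sym[OF p]
      by (simp add: D_metric[OF p] distrib_left sum.distrib mult.commute)
    also have "(\<Sum>m\<in>UNIV. H i m p * (\<Sum>n\<in>UNIV. \<Gamma> n k m p * G n l p))
        = (\<Sum>m\<in>UNIV. \<Sum>n\<in>UNIV. G l n p * (\<Gamma> n k m p * H m i p))"
      using metric_sym[OF p, of l] sym[of i] by (simp add: sum_distrib_left mult_ac)
    also have "\<dots> = (\<Sum>n\<in>UNIV. G l n p * (\<Sum>m\<in>UNIV. \<Gamma> n k m p * H m i p))"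
      by (subst sum.swap) (simp add: sum_distrib_left)
    finally show ?thesis by (simp add: raise_lower[OF p])
  qed
  then have "D k (\<lambda>q. H i j q) p
      = - (\<Sum>l\<in>UNIV. H j l p * (\<Sum>n\<in>UNIV. G l n p * (\<Sum>m\<in>UNIV. \<Gamma> n k m p * H m i p)))
        - (\<Sum>l\<in>UNIV. H j l p * \<Gamma> i k l p)"
    unfolding D_inverse_metric_sandwich[OF p] by (simp add: distrib_left sum.distrib)
  then show ?thesis
    unfolding raise_lower[OF p] using sym[of j] by (simp add: mult.commute)
qed

text \<open>
  The contracted symbol is the derivative of \<open>ln (sqrt (det g))\<close>, written here without the determinant:
  of the three derivatives of \<open>g\<close> in \<open>\<Gamma>\<close>, two cancel by the symmetry of \<open>g\<^sup>b\<^sup>l\<close>.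
\<close>

lemma contracted_christoffel:
  assumes p: "p \<in> U"
  shows "(\<Sum>b\<in>UNIV. \<Gamma> b b m p) = (1/2) * (\<Sum>b\<in>UNIV. \<Sum>l\<in>UNIV. H b l p * D m (\<lambda>q. G b l q) p)"
proof -
  have "(\<Sum>b\<in>UNIV. \<Gamma> b b m p) = (1/2) * ((\<Sum>b\<in>UNIV. \<Sum>l\<in>UNIV. H b l p * D b (\<lambda>q. G m l q) p)
    + (\<Sum>b\<in>UNIV. \<Sum>l\<in>UNIV. H b l p * D m (\<lambda>q. G b l q) p)
    - (\<Sum>b\<in>UNIV. \<Sum>l\<in>UNIV. H b l p * D l (\<lambda>q. G b m q) p))"
    unfolding christoffel_def sum_distrib_left[symmetric]
    by (simp add: sum.distrib sum_subtractf distrib_left right_diff_distrib)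
  also have "(\<Sum>b\<in>UNIV. \<Sum>l\<in>UNIV. H b l p * D l (\<lambda>q. G b m q) p)
      = (\<Sum>b\<in>UNIV. \<Sum>l\<in>UNIV. H b l p * D b (\<lambda>q. G m l q) p)"
    by (subst sum.swap) (simp add: inverse_metric(3)[OF p] D_metric_sym[OF p, of _ m])
  finally show ?thesis by simp
qed

text \<open>
  By the formula for \<open>\<partial>(g\<^sup>-\<^sup>1)\<close>, the left side is minus the trace of
  \<open>g\<^sup>-\<^sup>1 (\<partial>\<^sub>a g) g\<^sup>-\<^sup>1 (\<partial>\<^sub>b g)\<close>, which is cyclic and hence symmetric in \<open>a\<close> and \<open>b\<close>.
\<close>

lemma sum_D_inverse_metric_sym:
  assumes p: "p \<in> U"
  shows "(\<Sum>i\<in>UNIV. \<Sum>j\<in>UNIV. D a (\<lambda>q. H i j q) p * D b (\<lambda>q. G i j q) p)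
    = (\<Sum>i\<in>UNIV. \<Sum>j\<in>UNIV. D b (\<lambda>q. H i j q) p * D a (\<lambda>q. G i j q) p)"
proof -
  define X where "X a b = (\<lambda>(i, j, m, l). H j l p * H i m p *
    D a (\<lambda>q. G m l q) p * D b (\<lambda>q. G i j q) p)" for a b
  have exp: "(\<Sum>i\<in>UNIV. \<Sum>j\<in>UNIV. D a (\<lambda>q. H i j q) p * D b (\<lambda>q. G i j q) p)
      = - (\<Sum>z\<in>UNIV. X a b z)" for a b
  proof -
    have "(\<Sum>i\<in>UNIV. \<Sum>j\<in>UNIV. D a (\<lambda>q. H i j q) p * D b (\<lambda>q. G i j q) p)
      = - (\<Sum>i\<in>UNIV. \<Sum>j\<in>UNIV. \<Sum>l\<in>UNIV. \<Sum>m\<in>UNIV. X a b (i, j, m, l))"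
      unfolding D_inverse_metric_sandwich[OF p] X_def
      by (simp add: sum_negf sum_distrib_left sum_distrib_right mult_ac)
    also have "\<dots> = - (\<Sum>i\<in>UNIV. \<Sum>j\<in>UNIV. \<Sum>m\<in>UNIV. \<Sum>l\<in>UNIV. X a b (i, j, m, l))"
      by (subst (3) sum.swap) (rule refl)
    finally show ?thesis
      by (simp add: sum.cartesian_product flip: UNIV_Times_UNIV)
  qed
  \<comment> \<open>Exchanging the index pairs \<open>(i, j)\<close> and \<open>(m, l)\<close> is the cyclic rotation of the trace.\<close>
  have "(\<Sum>z\<in>UNIV. X a b z) = (\<Sum>z\<in>UNIV. X b a z)"
    by (rule sum.reindex_bij_witness[of _ "\<lambda>(i, j, m, l). (m, l, i, j)" "\<lambda>(i, j, m, l). (m, l, i, j)"])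
      (use inverse_metric(3)[OF p] in \<open>auto simp: X_def mult_ac\<close>)
  then show ?thesis unfolding exp by simp
qed

section \<open>Covariant derivatives in a chart\<close>

text \<open>
  The operators below only read the components of a vector field in the chart \<open>c\<close>, so smoothness of
  these components is the notion under which they are closed.
\<close>

definition smooth_components :: "('a, 'n) tensor_field \<Rightarrow> bool" where
  "smooth_components V \<longleftrightarrow> (\<forall>i. chart_smooth c (\<lambda>q. V q c [i] []))"

text \<open>
  \<open>N V a k\<close> is \<open>\<nabla>\<^sub>k V\<^sup>a\<close> and \<open>NN V a j k\<close> is \<open>\<nabla>\<^sub>j \<nabla>\<^sub>k V\<^sup>a\<close>.
\<close>

abbreviation "N V a k p \<equiv> nabla g V p c [a] [k]"
abbreviation "NN V a j k p \<equiv> nabla g (nabla g V) p c [a] [j, k]"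

lemma nabla_function: "nabla g u p c [] [k] = D k (\<lambda>q. u q c [] []) p"
  by (simp add: nabla_def)

lemma nabla_vector:
  "nabla g V p c [a] [k] = D k (\<lambda>q. V q c [a] []) p + (\<Sum>m\<in>UNIV. \<Gamma> a k m p * V p c [m] [])"
  by (simp add: nabla_def)

lemma nabla_mixed:
  "nabla g T p c [a] [k, j] = D k (\<lambda>q. T q c [a] [j]) p
    + (\<Sum>m\<in>UNIV. \<Gamma> a k m p * T p c [m] [j]) - (\<Sum>m\<in>UNIV. \<Gamma> m k j p * T p c [a] [m])"
  by (simp add: nabla_def)

lemma nabla_covector:
  "nabla g w p c [] [k, j] = D k (\<lambda>q. w q c [] [j]) p - (\<Sum>m\<in>UNIV. \<Gamma> m k j p * w p c [] [m])"
  by (simp add: nabla_def)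

lemma nabla_bilinear:
  "nabla g h p c [] [k, i, j] = D k (\<lambda>q. h q c [] [i, j]) p
    - (\<Sum>m\<in>UNIV. \<Gamma> m k i p * h p c [] [m, j]) - (\<Sum>m\<in>UNIV. \<Gamma> m k j p * h p c [] [i, m])"
  by (simp add: nabla_def lessThan_Suc)

lemma smooth_vector_component:
  "smooth_components V \<Longrightarrow> chart_smooth c (\<lambda>q. V q c [a] [])"
  by (simp add: smooth_components_def)

lemma smooth_nabla_vector:
  "smooth_components V \<Longrightarrow> chart_smooth c (\<lambda>q. N V a k q)"
  unfolding nabla_vector by (intro smooth_rules smooth_geometry smooth_vector_component)

lemma smooth_nabla_nabla_vector:
  "smooth_components V \<Longrightarrow> chart_smooth c (\<lambda>q. NN V a j k q)"
  unfolding nabla_mixed by (intro smooth_rules smooth_geometry smooth_nabla_vector)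

lemmas smooth_tensors =
  smooth_rules smooth_geometry smooth_vector_component smooth_nabla_vector smooth_nabla_nabla_vector

text \<open>
  Lowering an index commutes with covariant differentiation. For an arbitrary family \<open>v\<close>,
  so that it also covers tensors with further indices: it is then the part of \<open>\<nabla>\<close> that concerns the
  lowered one.
\<close>

lemma D_lowered:
  assumes p: "p \<in> U" and v: "\<And>l. chart_smooth c (v l)"
  shows "D k (\<lambda>q. \<Sum>l\<in>UNIV. G j l q * v l q) p - (\<Sum>m\<in>UNIV. \<Gamma> m k j p * (\<Sum>l\<in>UNIV. G m l p * v l p))
    = (\<Sum>l\<in>UNIV. G j l p * (D k (v l) p + (\<Sum>m\<in>UNIV. \<Gamma> l k m p * v m p)))"
proof -
  have "D k (\<lambda>q. \<Sum>l\<in>UNIV. G j l q * v l q) p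
      = (\<Sum>l\<in>UNIV. G j l p * D k (v l) p)
      + (\<Sum>l\<in>UNIV. \<Sum>m\<in>UNIV. \<Gamma> m k j p * (G m l p * v l p))
      + (\<Sum>l\<in>UNIV. \<Sum>m\<in>UNIV. G j m p * (\<Gamma> m k l p * v l p))"
    using metric_sym[OF p, of j]
    by (simp add: D_rules smooth_tensors p v D_metric[OF p] sum.distrib sum_distrib_left
        sum_distrib_right algebra_simps)
  moreover have "(\<Sum>l\<in>UNIV. \<Sum>m\<in>UNIV. \<Gamma> m k j p * (G m l p * v l p))
      = (\<Sum>m\<in>UNIV. \<Gamma> m k j p * (\<Sum>l\<in>UNIV. G m l p * v l p))"
    by (subst sum.swap) (simp add: sum_distrib_left)
  moreover have "(\<Sum>l\<in>UNIV. \<Sum>m\<in>UNIV. G j m p * (\<Gamma> m k l p * v l p))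
      = (\<Sum>m\<in>UNIV. G j m p * (\<Sum>l\<in>UNIV. \<Gamma> m k l p * v l p))"
    by (subst sum.swap) (simp add: sum_distrib_left)
  ultimately show ?thesis
    by (simp add: sum.distrib distrib_left)
qed

text \<open>
  The counterpart of \<open>D_lowered\<close> for \<open>g\<^sup>-\<^sup>1\<close>.
\<close>

lemma D_raised:
  assumes p: "p \<in> U" and v: "\<And>l. chart_smooth c (v l)"
  shows "D k (\<lambda>q. \<Sum>l\<in>UNIV. H j l q * v l q) p + (\<Sum>m\<in>UNIV. \<Gamma> j k m p * (\<Sum>l\<in>UNIV. H m l p * v l p))
    = (\<Sum>l\<in>UNIV. H j l p * (D k (v l) p - (\<Sum>m\<in>UNIV. \<Gamma> m k l p * v m p)))"
proof -
  have "D k (\<lambda>q. \<Sum>l\<in>UNIV. H j l q * v l q) p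
      = (\<Sum>l\<in>UNIV. H j l p * D k (v l) p)
      - (\<Sum>l\<in>UNIV. \<Sum>m\<in>UNIV. \<Gamma> j k m p * (H m l p * v l p))
      - (\<Sum>l\<in>UNIV. \<Sum>m\<in>UNIV. H j m p * (\<Gamma> l k m p * v l p))"
    using inverse_metric(3)[OF p, of j]
    by (simp add: D_rules smooth_tensors p v D_inverse_metric[OF p] sum.distrib sum_distrib_left
        sum_distrib_right sum_subtractf sum_negf algebra_simps)
  moreover have "(\<Sum>l\<in>UNIV. \<Sum>m\<in>UNIV. \<Gamma> j k m p * (H m l p * v l p))
      = (\<Sum>m\<in>UNIV. \<Gamma> j k m p * (\<Sum>l\<in>UNIV. H m l p * v l p))"
    by (subst sum.swap) (simp add: sum_distrib_left)
  moreover have "(\<Sum>l\<in>UNIV. \<Sum>m\<in>UNIV. H j m p * (\<Gamma> l k m p * v l p))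
      = (\<Sum>m\<in>UNIV. H j m p * (\<Sum>l\<in>UNIV. \<Gamma> l k m p * v l p))"
    by (subst sum.swap) (simp add: sum_distrib_left)
  ultimately show ?thesis
    by (simp add: sum_subtractf right_diff_distrib)
qed

text \<open>
  After expanding both sides, the terms with second derivatives of \<open>V\<close> agree by the symmetry of
  partial derivatives, those with \<open>\<nabla>V\<close> in the Christoffel correction of the covariant index agree by
  the symmetry of \<open>\<Gamma>\<close>, and those with first derivatives of \<open>V\<close> are symmetric in \<open>k\<close> and \<open>j\<close>.
\<close>

lemma ricci_identity:
  assumes p: "p \<in> U" and V: "smooth_components V"
  shows "NN V a k j p - NN V a j k p = (\<Sum>b\<in>UNIV. riemann g p c a b k j * V p c [b] [])"
proof -
  let ?v = "\<lambda>b q. V q c [b] []"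
  have exp: "NN V a k j p = D k (D j (?v a)) p
      + (\<Sum>b\<in>UNIV. D k (\<lambda>q. \<Gamma> a j b q) p * ?v b p)
      + ((\<Sum>b\<in>UNIV. \<Gamma> a j b p * D k (?v b) p) + (\<Sum>m\<in>UNIV. \<Gamma> a k m p * D j (?v m) p))
      + (\<Sum>m\<in>UNIV. \<Sum>b\<in>UNIV. \<Gamma> a k m p * \<Gamma> m j b p * ?v b p)
      - (\<Sum>m\<in>UNIV. \<Gamma> m k j p * N V a m p)" for k j
  proof -
    have "D k (\<lambda>q. N V a j q) p = D k (D j (?v a)) p
      + ((\<Sum>b\<in>UNIV. \<Gamma> a j b p * D k (?v b) p) + (\<Sum>b\<in>UNIV. D k (\<lambda>q. \<Gamma> a j b q) p * ?v b p))"
      unfolding nabla_vector by (simp add: D_rules smooth_tensors p V sum.distrib)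
    moreover have "(\<Sum>m\<in>UNIV. \<Gamma> a k m p * N V m j p) = (\<Sum>m\<in>UNIV. \<Gamma> a k m p * D j (?v m) p)
      + (\<Sum>m\<in>UNIV. \<Sum>b\<in>UNIV. \<Gamma> a k m p * \<Gamma> m j b p * ?v b p)"
      unfolding nabla_vector by (simp add: distrib_left sum.distrib sum_distrib_left mult.assoc)
    ultimately show ?thesis unfolding nabla_mixed by simp
  qed
  have "D k (D j (?v a)) p = D j (D k (?v a)) p"
    by (intro D_commute p smooth_vector_component V)
  moreover have "(\<Sum>m\<in>UNIV. \<Gamma> m k j p * N V a m p) = (\<Sum>m\<in>UNIV. \<Gamma> m j k p * N V a m p)"
    using christoffel_sym[OF p] by simp
  moreover have "(\<Sum>m\<in>UNIV. \<Sum>b\<in>UNIV. \<Gamma> a k m p * \<Gamma> m j b p * ?v b p)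
      = (\<Sum>b\<in>UNIV. (\<Sum>m\<in>UNIV. \<Gamma> a k m p * \<Gamma> m j b p) * ?v b p)" for k j
    by (subst sum.swap) (simp add: sum_distrib_right)
  ultimately show ?thesis
    unfolding exp riemann_def
    by (simp add: sum.distrib sum_subtractf distrib_right left_diff_distrib)
qed

text \<open>
  In the contraction with the derivatives exchanged, the two Christoffel corrections cancel, so that
  \<open>\<nabla>\<^sub>i \<nabla>\<^sub>l V\<^sup>l\<close> is the partial derivative of the divergence.
\<close>

lemma contracted_ricci_identity:
  assumes p: "p \<in> U" and V: "smooth_components V"
  shows "(\<Sum>l\<in>UNIV. NN V l l i p) =
    D i (\<lambda>q. \<Sum>l\<in>UNIV. N V l l q) p + (\<Sum>b\<in>UNIV. ricci g p c b i * V p c [b] [])"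
proof -
  have "(\<Sum>l\<in>UNIV. NN V l l i p) = (\<Sum>l\<in>UNIV. NN V l i l p)
      + (\<Sum>l\<in>UNIV. \<Sum>b\<in>UNIV. riemann g p c l b l i * V p c [b] [])"
    by (simp add: sum.distrib[symmetric] ricci_identity[OF p V, symmetric])
  also have "(\<Sum>l\<in>UNIV. \<Sum>b\<in>UNIV. riemann g p c l b l i * V p c [b] [])
      = (\<Sum>b\<in>UNIV. ricci g p c b i * V p c [b] [])"
    by (subst sum.swap) (simp add: ricci_def sum_distrib_right)
  also have "(\<Sum>l\<in>UNIV. NN V l i l p) = D i (\<lambda>q. \<Sum>l\<in>UNIV. N V l l q) p
      + (\<Sum>l\<in>UNIV. \<Sum>m\<in>UNIV. \<Gamma> l i m p * N V m l p) - (\<Sum>l\<in>UNIV. \<Sum>m\<in>UNIV. \<Gamma> m i l p * N V l m p)"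
    unfolding nabla_mixed by (simp add: D_rules smooth_tensors p V sum.distrib sum_subtractf)
  also have "(\<Sum>l\<in>UNIV. \<Sum>m\<in>UNIV. \<Gamma> m i l p * N V l m p) = (\<Sum>l\<in>UNIV. \<Sum>m\<in>UNIV. \<Gamma> l i m p * N V m l p)"
    by (rule sum.swap)
  finally show ?thesis by simp
qed

end

section \<open>The weighted operators in a chart\<close>

text \<open>
  The next two lemmas carry the factor and the two summands of \<open>div_f_adj\<close> through a contraction.
\<close>

lemma sum_mult_symmetrised:
  fixes x u v :: "'i \<Rightarrow> real"
  shows "(\<Sum>i\<in>I. x i * (- (1/2) * (u i + v i))) = - (1/2) * ((\<Sum>i\<in>I. x i * u i) + (\<Sum>i\<in>I. x i * v i))"
  unfolding sum.distrib[symmetric] sum_distrib_left by (rule sum.cong) (simp_all add: algebra_simps)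

lemma sum_symmetrised:
  fixes u v :: "'i \<Rightarrow> real"
  shows "(\<Sum>i\<in>I. - (1/2) * (u i + v i)) = - (1/2) * ((\<Sum>i\<in>I. u i) + (\<Sum>i\<in>I. v i))"
  using sum_mult_symmetrised[of "\<lambda>_. 1"] by simp

lemma sum_antisym_eq_0:
  fixes X :: "'i::finite \<Rightarrow> 'i \<Rightarrow> real"
  assumes "\<And>a b. X a b = - X b a"
  shows "(\<Sum>a\<in>UNIV. \<Sum>b\<in>UNIV. X a b) = 0"
proof -
  have "(\<Sum>a\<in>UNIV. \<Sum>b\<in>UNIV. X a b) = (\<Sum>a\<in>UNIV. \<Sum>b\<in>UNIV. - X b a)"
    using assms by (intro sum.cong refl)
  also have "\<dots> = - (\<Sum>a\<in>UNIV. \<Sum>b\<in>UNIV. X a b)"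
    unfolding sum_negf by (subst sum.swap) (rule refl)
  finally show ?thesis by simp
qed

locale weighted_chart = metric_chart c g for c :: "('a, 'n::finite) chart" and g +
  fixes f :: "'a \<Rightarrow> real"
  assumes smooth_potential: "chart_smooth c f"
begin

text \<open>
  The tensor \<open>T\<^sup>a\<^sup>b\<close>, with the derivative index in second place.
\<close>

definition raised :: "('a, 'n) tensor_field \<Rightarrow> 'n \<Rightarrow> 'n \<Rightarrow> 'a \<Rightarrow> real" where
  "raised V a b p = (\<Sum>k\<in>UNIV. H b k p * N V a k p)"

text \<open>
  The derivative of the logarithm of the weighted volume density \<open>exp (- f) * sqrt (det g)\<close>. In terms of
  it, weighted divergences of vector fields and antisymmetric tensors are \<open>\<partial>\<^sub>b + drift\<^sub>b\<close>.
\<close>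

definition drift :: "'n \<Rightarrow> 'a \<Rightarrow> real" where
  "drift i p = (\<Sum>l\<in>UNIV. \<Gamma> l l i p) - D i f p"

text \<open>
  The weighted divergence of \<open>T\<close> in its first index, \<open>\<nabla>\<^sub>l T\<^sup>l\<^sup>a - f\<^sub>l T\<^sup>l\<^sup>a\<close>; with the second index in
  place of the first it would be the drift Laplacian of \<open>V\<close>.
\<close>

definition drift_transpose :: "('a, 'n) tensor_field \<Rightarrow> 'n \<Rightarrow> 'a \<Rightarrow> real" where
  "drift_transpose V a p =
    (\<Sum>i\<in>UNIV. H a i p * (\<Sum>l\<in>UNIV. NN V l l i p - D l f p * N V l i p))"

lemma smooth_raised: "smooth_components V \<Longrightarrow> chart_smooth c (\<lambda>q. raised V a b q)"
  unfolding raised_def by (intro smooth_tensors)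

lemma smooth_drift: "chart_smooth c (\<lambda>q. drift i q)"
  unfolding drift_def by (intro smooth_tensors smooth_potential)

lemma grad_potential: "grad g (scalar f) p c [k] [] = (\<Sum>l\<in>UNIV. H k l p * D l f p)"
  by (simp add: grad_def nabla_function scalar_def)

text \<open>
  Both sides are \<open>\<nabla>\<^sub>k T\<^sup>a\<^sup>b\<close>: on the left by the formula for a contravariant tensor, on the right with
  the metric pulled out of the derivative.
\<close>

lemma nabla_raised:
  assumes p: "p \<in> U" and V: "smooth_components V"
  shows "D k (\<lambda>q. raised V a b q) p
      + (\<Sum>m\<in>UNIV. \<Gamma> a k m p * raised V m b p) + (\<Sum>m\<in>UNIV. \<Gamma> b k m p * raised V a m p)
    = (\<Sum>l\<in>UNIV. H b l p * NN V a k l p)"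
proof -
  have "D k (\<lambda>q. raised V a b q) p + (\<Sum>m\<in>UNIV. \<Gamma> b k m p * raised V a m p)
      = (\<Sum>l\<in>UNIV. H b l p * (D k (\<lambda>q. N V a l q) p - (\<Sum>m\<in>UNIV. \<Gamma> m k l p * N V a m p)))"
    unfolding raised_def by (intro D_raised p smooth_nabla_vector V)
  moreover have "(\<Sum>m\<in>UNIV. \<Gamma> a k m p * raised V m b p)
      = (\<Sum>l\<in>UNIV. H b l p * (\<Sum>m\<in>UNIV. \<Gamma> a k m p * N V m l p))"
    unfolding raised_def sum_distrib_left by (subst sum.swap) (simp add: mult_ac)
  ultimately show ?thesis
    unfolding nabla_mixed
    by (simp add: sum.distrib sum_subtractf distrib_left right_diff_distrib)
qed

lemma drift_laplacian_raised:
  assumes p: "p \<in> U" and V: "smooth_components V"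
  shows "drift_laplacian g f V p c [a] [] = (\<Sum>b\<in>UNIV. D b (\<lambda>q. raised V a b q) p
      + (\<Sum>m\<in>UNIV. \<Gamma> a b m p * raised V m b p) + (\<Sum>m\<in>UNIV. \<Gamma> b b m p * raised V a m p)
      - D b f p * raised V a b p)"
proof -
  have "nabla_dir g (grad g (scalar f)) V p c [a] []
      = (\<Sum>k\<in>UNIV. \<Sum>b\<in>UNIV. H k b p * D b f p * N V a k p)"
    by (simp add: nabla_dir_def grad_potential sum_distrib_right)
  also have "\<dots> = (\<Sum>b\<in>UNIV. D b f p * raised V a b p)"
    unfolding raised_def sum_distrib_left using inverse_metric(3)[OF p]
    by (subst sum.swap) (simp add: mult_ac)
  finally show ?thesis
    unfolding drift_laplacian_def laplacian_def sum_subtractf nabla_raised[OF p V] by simp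
qed

lemma drift_transpose_raised:
  assumes p: "p \<in> U" and V: "smooth_components V"
  shows "drift_transpose V a p = (\<Sum>b\<in>UNIV. D b (\<lambda>q. raised V b a q) p
      + (\<Sum>m\<in>UNIV. \<Gamma> b b m p * raised V m a p) + (\<Sum>m\<in>UNIV. \<Gamma> a b m p * raised V b m p)
      - D b f p * raised V b a p)"
proof -
  have "drift_transpose V a p
      = (\<Sum>i\<in>UNIV. \<Sum>b\<in>UNIV. H a i p * NN V b b i p - D b f p * (H a i p * N V b i p))"
    unfolding drift_transpose_def by (simp add: sum_distrib_left algebra_simps)
  also have "\<dots> = (\<Sum>b\<in>UNIV. (\<Sum>i\<in>UNIV. H a i p * NN V b b i p) - D b f p * raised V b a p)"
    unfolding raised_def by (subst sum.swap) (simp add: sum_subtractf sum_distrib_left)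
  finally show ?thesis unfolding nabla_raised[OF p V, symmetric] by simp
qed

text \<open>
  On the antisymmetric part of \<open>T\<close>, the Christoffel correction of the free index \<open>a\<close> is a contraction
  with a symmetric symbol and vanishes. What remains involves \<open>\<Gamma>\<close> only through its trace, that is,
  through \<open>drift\<close>.
\<close>

lemma drift_laplacian_minus_transpose:
  assumes p: "p \<in> U" and V: "smooth_components V"
  shows "drift_laplacian g f V p c [a] [] - drift_transpose V a p =
    (\<Sum>b\<in>UNIV. D b (\<lambda>q. raised V a b q - raised V b a q) p
      + drift b p * (raised V a b p - raised V b a p))"
proof -
  have "(\<Sum>b\<in>UNIV. \<Sum>m\<in>UNIV. \<Gamma> a b m p * raised V m b p)
      = (\<Sum>b\<in>UNIV. \<Sum>m\<in>UNIV. \<Gamma> a b m p * raised V b m p)"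
    using christoffel_sym[OF p, of a] by (subst sum.swap) simp
  moreover have "(\<Sum>b\<in>UNIV. drift b p * X b)
      = (\<Sum>b\<in>UNIV. \<Sum>m\<in>UNIV. \<Gamma> b b m p * X m) - (\<Sum>b\<in>UNIV. D b f p * X b)" for X
    unfolding drift_def left_diff_distrib sum_subtractf sum_distrib_right
    by (subst sum.swap) simp
  ultimately show ?thesis
    unfolding drift_laplacian_raised[OF p V] drift_transpose_raised[OF p V]
    by (simp add: D_diff smooth_raised p V sum.distrib sum_subtractf right_diff_distrib)
qed

lemma nabla_flat:
  assumes p: "p \<in> U" and V: "smooth_components V"
  shows "nabla g (flat g V) p c [] [k, j] = (\<Sum>l\<in>UNIV. G j l p * N V l k p)"
  unfolding nabla_covector nabla_vector using D_lowered[OF p smooth_vector_component[OF V], where k = k and j = j]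
  by (simp add: flat_def)

text \<open>
  The left side is the covariant derivative of the tensor \<open>g\<^sub>j\<^sub>l \<nabla>\<^sub>i V\<^sup>l\<close>.
\<close>

lemma nabla_nabla_flat:
  assumes p: "p \<in> U" and V: "smooth_components V"
  shows "D k (\<lambda>q. \<Sum>l\<in>UNIV. G j l q * N V l i q) p
      - (\<Sum>m\<in>UNIV. \<Gamma> m k i p * (\<Sum>l\<in>UNIV. G j l p * N V l m p))
      - (\<Sum>m\<in>UNIV. \<Gamma> m k j p * (\<Sum>l\<in>UNIV. G m l p * N V l i p))
    = (\<Sum>l\<in>UNIV. G j l p * NN V l k i p)"
proof -
  have "(\<Sum>m\<in>UNIV. \<Gamma> m k i p * (\<Sum>l\<in>UNIV. G j l p * N V l m p))
      = (\<Sum>l\<in>UNIV. G j l p * (\<Sum>m\<in>UNIV. \<Gamma> m k i p * N V l m p))"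
    unfolding sum_distrib_left by (subst sum.swap) (simp add: mult_ac)
  with D_lowered[OF p smooth_nabla_vector[OF V], where k = k and j = j] show ?thesis
    unfolding nabla_mixed by (simp add: sum_subtractf right_diff_distrib)
qed

lemma nabla_div_f_adj:
  assumes p: "p \<in> U" and V: "smooth_components V"
  shows "nabla g (div_f_adj g V) p c [] [k, i, j] =
    - (1/2) * ((\<Sum>l\<in>UNIV. G j l p * NN V l k i p) + (\<Sum>l\<in>UNIV. G i l p * NN V l k j p))"
proof -
  define K where "K i j q = (\<Sum>l\<in>UNIV. G j l q * N V l i q)" for i j q
  have h: "div_f_adj g V q c [] [i, j] = - (1/2) * (K i j q + K j i q)" if "q \<in> U" for i j q
    by (simp add: div_f_adj_def nabla_flat[OF that V] K_def)
  have smooth_K: "chart_smooth c (\<lambda>q. K i j q)" for i j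
    unfolding K_def by (intro smooth_tensors V)
  have "D k (\<lambda>q. div_f_adj g V q c [] [i, j]) p = D k (\<lambda>q. - (1/2) * (K i j q + K j i q)) p"
    by (rule D_cong[OF p]) (rule h)
  also have "\<dots> = - (1/2) * (D k (\<lambda>q. K i j q) p + D k (\<lambda>q. K j i q) p)"
    by (simp only: D_cmult D_add smooth_K smooth_rules p)
  finally have "nabla g (div_f_adj g V) p c [] [k, i, j] = - (1/2) *
     ((D k (\<lambda>q. K i j q) p - (\<Sum>m\<in>UNIV. \<Gamma> m k i p * K m j p) - (\<Sum>m\<in>UNIV. \<Gamma> m k j p * K i m p))
    + (D k (\<lambda>q. K j i q) p - (\<Sum>m\<in>UNIV. \<Gamma> m k j p * K m i p) - (\<Sum>m\<in>UNIV. \<Gamma> m k i p * K j m p)))"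
    unfolding nabla_bilinear h[OF p] sum_mult_symmetrised by (simp only: algebra_simps)
  then show ?thesis
    unfolding K_def nabla_nabla_flat[OF p V] .
qed

text \<open>
  In \<open>div_f_adj g V\<close> the derivative index of \<open>\<nabla>V\<close> is contracted by the divergence in one summand and
  the vector index in the other; the first gives the drift Laplacian and the second its transpose.
\<close>

lemma P_op_eq:
  assumes p: "p \<in> U" and V: "smooth_components V"
  shows "P_op g f V p c [a] [] =
    - (1/2) * (drift_laplacian g f V p c [a] [] + drift_transpose V a p)"
proof -
  \<comment> \<open>\<open>Y l k j\<close> is \<open>\<nabla>\<^sub>k \<nabla>\<^sub>j V\<^sup>l - f\<^sub>k \<nabla>\<^sub>j V\<^sup>l\<close>, the summand common to both divergences, and \<open>Z\<close> its trace over
      \<open>k\<close> and \<open>j\<close>, the drift Laplacian.\<close>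
  define Y where "Y l k j = NN V l k j p - D k f p * N V l j p" for l k j
  define Z where "Z l = (\<Sum>j\<in>UNIV. \<Sum>k\<in>UNIV. H j k p * Y l k j)" for l
  have form: "div_f_sym_form g f (div_f_adj g V) p c [] [i]
      = - (1/2) * ((\<Sum>k\<in>UNIV. Y k k i) + (\<Sum>l\<in>UNIV. G i l p * Z l))" for i
  proof -
    have "nabla g (div_f_adj g V) p c [] [k, i, j] - D k f p * div_f_adj g V p c [] [i, j]
        = - (1/2) * ((\<Sum>l\<in>UNIV. G j l p * Y l k i) + (\<Sum>l\<in>UNIV. G i l p * Y l k j))" for j k
      by (simp add: nabla_div_f_adj[OF p V] div_f_adj_def nabla_flat[OF p V] Y_def
          sum_subtractf sum_distrib_left sum_distrib_right sum.distrib algebra_simps sum_divide_distrib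
          add_divide_distrib)
    then have "div_f_sym_form g f (div_f_adj g V) p c [] [i]
      = - (1/2) * ((\<Sum>j\<in>UNIV. \<Sum>k\<in>UNIV. H j k p * (\<Sum>l\<in>UNIV. G j l p * Y l k i))
        + (\<Sum>j\<in>UNIV. \<Sum>k\<in>UNIV. H j k p * (\<Sum>l\<in>UNIV. G i l p * Y l k j)))"
      by (simp only: div_f_sym_form_def nabla_function scalar_def list.sel sum_mult_symmetrised
          sum_symmetrised)
    also have "(\<Sum>j\<in>UNIV. \<Sum>k\<in>UNIV. H j k p * (\<Sum>l\<in>UNIV. G j l p * Y l k i))
        = (\<Sum>k\<in>UNIV. \<Sum>j\<in>UNIV. H k j p * (\<Sum>l\<in>UNIV. G j l p * Y l k i))"
      using inverse_metric(3)[OF p] by (subst sum.swap) simp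
    also have "\<dots> = (\<Sum>k\<in>UNIV. Y k k i)" by (simp add: raise_lower[OF p])
    also have "(\<Sum>j\<in>UNIV. \<Sum>k\<in>UNIV. H j k p * (\<Sum>l\<in>UNIV. G i l p * Y l k j))
        = (\<Sum>j\<in>UNIV. \<Sum>l\<in>UNIV. \<Sum>k\<in>UNIV. G i l p * (H j k p * Y l k j))"
      unfolding sum_distrib_left by (subst (2) sum.swap) (simp add: mult_ac)
    also have "\<dots> = (\<Sum>l\<in>UNIV. G i l p * Z l)"
      unfolding Z_def sum_distrib_left by (rule sum.swap)
    finally show ?thesis .
  qed
  have "P_op g f V p c [a] []
      = - (1/2) * ((\<Sum>i\<in>UNIV. H a i p * (\<Sum>k\<in>UNIV. Y k k i))
        + (\<Sum>i\<in>UNIV. H a i p * (\<Sum>l\<in>UNIV. G i l p * Z l)))"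
    by (simp only: P_op_def div_f_sym_def sharp_def form list.sel sum_mult_symmetrised)
  also have "(\<Sum>i\<in>UNIV. H a i p * (\<Sum>k\<in>UNIV. Y k k i)) = drift_transpose V a p"
    by (simp add: drift_transpose_def Y_def)
  also have "(\<Sum>i\<in>UNIV. H a i p * (\<Sum>l\<in>UNIV. G i l p * Z l)) = Z a"
    by (rule raise_lower[OF p])
  also have "Z a = drift_laplacian g f V p c [a] []"
  proof -
    have "Z a = (\<Sum>j\<in>UNIV. \<Sum>k\<in>UNIV. H k j p * NN V a k j p)
        - (\<Sum>j\<in>UNIV. \<Sum>k\<in>UNIV. H j k p * D k f p * N V a j p)"
      unfolding Z_def Y_def using inverse_metric(3)[OF p]
      by (simp add: sum_subtractf right_diff_distrib mult.assoc)
    also have "(\<Sum>j\<in>UNIV. \<Sum>k\<in>UNIV. H k j p * NN V a k j p)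
        = (\<Sum>k\<in>UNIV. \<Sum>j\<in>UNIV. H k j p * NN V a k j p)"
      by (rule sum.swap)
    finally show ?thesis
      by (simp add: drift_laplacian_def laplacian_def nabla_dir_def grad_potential sum_distrib_right)
  qed
  finally show ?thesis by (simp only: add.commute)
qed

text \<open>
  \<open>drift\<close> is a gradient, so its derivative is symmetric. Away from second derivatives of \<open>g\<close> and \<open>f\<close>,
  this is the symmetry of the trace in \<open>sum_D_inverse_metric_sym\<close>.
\<close>

lemma D_drift_sym:
  assumes p: "p \<in> U"
  shows "D a (\<lambda>q. drift b q) p = D b (\<lambda>q. drift a q) p"
proof -
  have exp: "D a (\<lambda>q. drift b q) p
      = (1/2) * ((\<Sum>i\<in>UNIV. \<Sum>j\<in>UNIV. H i j p * D a (D b (\<lambda>q. G i j q)) p)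
        + (\<Sum>i\<in>UNIV. \<Sum>j\<in>UNIV. D a (\<lambda>q. H i j q) p * D b (\<lambda>q. G i j q) p)) - D a (D b f) p" for a b
  proof -
    have "D a (\<lambda>q. drift b q) p = D a (\<lambda>q. (1/2) * (\<Sum>i\<in>UNIV. \<Sum>j\<in>UNIV. H i j q * D b (\<lambda>q. G i j q) q) - D b f q) p"
      by (rule D_cong[OF p]) (simp add: drift_def contracted_christoffel)
    also have "\<dots> = (1/2) * (\<Sum>i\<in>UNIV. \<Sum>j\<in>UNIV. H i j p * D a (D b (\<lambda>q. G i j q)) p
        + D a (\<lambda>q. H i j q) p * D b (\<lambda>q. G i j q) p) - D a (D b f) p"
      by (simp only: D_diff D_cmult D_sum D_mult smooth_rules smooth_geometry smooth_potential p)
    finally show ?thesis by (simp only: sum.distrib)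
  qed
  have "D a (D b (\<lambda>q. G i j q)) p = D b (D a (\<lambda>q. G i j q)) p" for i j
    by (intro D_commute p smooth_metric)
  moreover have "D a (D b f) p = D b (D a f) p"
    by (intro D_commute p smooth_potential)
  ultimately show ?thesis unfolding exp by (simp only: sum_D_inverse_metric_sym[OF p, of a b])
qed

lemma div_f_nabla:
  assumes p: "p \<in> U"
  shows "div_f g f V p c is js = (\<Sum>l\<in>UNIV. N V l l p) - (\<Sum>l\<in>UNIV. V p c [l] [] * D l f p)"
proof -
  have "inner_field g V (grad g (scalar f)) p c is js
      = (\<Sum>i\<in>UNIV. V p c [i] [] * (\<Sum>j\<in>UNIV. G i j p * (\<Sum>l\<in>UNIV. H j l p * D l f p)))"
    unfolding inner_field_def grad_potential by (simp add: sum_distrib_left mult_ac)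
  then show ?thesis by (simp only: div_f_def divergence_def lower_raise[OF p])
qed

lemma div_f_eq:
  assumes p: "p \<in> U"
  shows "div_f g f V p c is js =
    (\<Sum>a\<in>UNIV. D a (\<lambda>q. V q c [a] []) p + drift a p * V p c [a] [])"
proof -
  have "div_f g f V p c is js = (\<Sum>a\<in>UNIV. D a (\<lambda>q. V q c [a] []) p)
      + (\<Sum>i\<in>UNIV. \<Sum>m\<in>UNIV. \<Gamma> i i m p * V p c [m] []) - (\<Sum>i\<in>UNIV. V p c [i] [] * D i f p)"
    unfolding div_f_nabla[OF p] nabla_vector by (simp add: sum.distrib)
  also have "(\<Sum>i\<in>UNIV. \<Sum>m\<in>UNIV. \<Gamma> i i m p * V p c [m] [])
      = (\<Sum>m\<in>UNIV. (\<Sum>i\<in>UNIV. \<Gamma> i i m p) * V p c [m] [])"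
    by (subst sum.swap) (simp add: sum_distrib_right)
  finally show ?thesis
    by (simp add: drift_def sum.distrib sum_subtractf algebra_simps)
qed

text \<open>
  Stated for \<open>z\<close> with \<open>z\<^sup>a = (\<partial>\<^sub>b + drift\<^sub>b) B\<^sup>a\<^sup>b\<close>. In \<open>(\<partial>\<^sub>a + drift\<^sub>a) z\<^sup>a\<close> the coefficients
  \<open>\<partial>\<^sub>a \<partial>\<^sub>b\<close>, \<open>\<partial>\<^sub>a drift\<^sub>b\<close> and \<open>drift\<^sub>a drift\<^sub>b\<close> are symmetric in \<open>a\<close> and \<open>b\<close>, and the two kinds of
  mixed terms are exchanged by swapping \<open>a\<close> and \<open>b\<close>; so the contraction with \<open>B\<close> vanishes.
\<close>

lemma div_f_div_f_antisym:
  assumes p: "p \<in> U" and smooth: "\<And>a b. chart_smooth c (B a b)"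
    and antisym: "\<And>a b q. q \<in> U \<Longrightarrow> B a b q = - B b a q"
    and Z: "\<And>a q. q \<in> U \<Longrightarrow> z a q = (\<Sum>b\<in>UNIV. D b (B a b) q + drift b q * B a b q)"
  shows "(\<Sum>a\<in>UNIV. D a (z a) p + drift a p * z a p) = 0"
proof -
  define X where "X a b = D a (D b (B a b)) p
      + (drift b p * D a (B a b) p + D a (\<lambda>q. drift b q) p * B a b p)
      + drift a p * (D b (B a b) p + drift b p * B a b p)" for a b
  have "D a (z a) p = (\<Sum>b\<in>UNIV. D a (D b (B a b)) p
      + (drift b p * D a (B a b) p + D a (\<lambda>q. drift b q) p * B a b p))" for a
  proof -
    have "D a (z a) p = D a (\<lambda>q. \<Sum>b\<in>UNIV. D b (B a b) q + drift b q * B a b q) p"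
      by (rule D_cong[OF p]) (rule Z)
    then show ?thesis
      by (simp only: D_sum D_add D_mult smooth_rules smooth smooth_drift p)
  qed
  then have "(\<Sum>a\<in>UNIV. D a (z a) p + drift a p * z a p) = (\<Sum>a\<in>UNIV. \<Sum>b\<in>UNIV. X a b)"
    by (simp only: Z[OF p] X_def sum_distrib_left sum.distrib distrib_left)
  also have "\<dots> = 0"
  proof (rule sum_antisym_eq_0)
    fix a b
    have DB: "D k (B a b) q = - D k (B b a) q" if "q \<in> U" for a b k q
    proof -
      have "D k (B a b) q = D k (\<lambda>q. - B b a q) q"
        by (rule D_cong[OF that]) (rule antisym)
      then show ?thesis by (simp only: D_minus smooth that)
    qed
    have "D a (D b (B a b)) p = D a (\<lambda>q. - D b (B b a) q) p"
      by (rule D_cong[OF p]) (rule DB)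
    also have "\<dots> = - D a (D b (B b a)) p"
      by (simp only: D_minus smooth smooth_rules p)
    also have "D a (D b (B b a)) p = D b (D a (B b a)) p"
      by (intro D_commute p smooth)
    finally show "X a b = - X b a"
      unfolding X_def DB[OF p, of _ a b] antisym[OF p, of a b] D_drift_sym[OF p, of a b]
      by (simp add: algebra_simps)
  qed
  finally show ?thesis .
qed

lemma hessian_eq: "hessian g f p c i j = D i (D j f) p - (\<Sum>m\<in>UNIV. \<Gamma> m i j p * D m f p)"
  by (simp add: hessian_def nabla_covector nabla_function scalar_def)

lemma hessian_sym:
  assumes p: "p \<in> U"
  shows "hessian g f p c i j = hessian g f p c j i"
  using D_commute[OF p smooth_potential] christoffel_sym[OF p] by (simp add: hessian_eq)

lemma smooth_components_drift_laplacian: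
  "smooth_components V \<Longrightarrow> smooth_components (drift_laplacian g f V)"
  unfolding smooth_components_def[of "drift_laplacian g f V"]
    drift_laplacian_def laplacian_def nabla_dir_def grad_potential
  by (intro allI smooth_rules smooth_geometry smooth_potential smooth_nabla_vector
      smooth_nabla_nabla_vector)

lemma smooth_div_f: "smooth_components V \<Longrightarrow> chart_smooth c (\<lambda>q. div_f g f V q c [] [])"
  by (rule chart_smooth_cong[OF div_f_eq[symmetric]], assumption)
    (intro smooth_tensors smooth_drift)

lemma smooth_components_grad:
  "chart_smooth c (\<lambda>q. u q c [] []) \<Longrightarrow> smooth_components (grad g u)"
  unfolding smooth_components_def grad_def nabla_function by (intro allI smooth_rules smooth_geometry)

lemma grad_eq: "grad g u p c [a] [] = (\<Sum>l\<in>UNIV. H a l p * D l (\<lambda>q. u q c [] []) p)"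
  by (simp add: grad_def nabla_function)

text \<open>
  For a gradient field, \<open>T\<close> is the Hessian of \<open>u\<close> with both indices raised.
\<close>

lemma raised_grad_sym:
  assumes p: "p \<in> U" and u: "chart_smooth c (\<lambda>q. u q c [] [])"
  shows "raised (grad g u) a b p = raised (grad g u) b a p"
proof -
  define h where "h k l = D k (D l (\<lambda>q. u q c [] [])) p - (\<Sum>m\<in>UNIV. \<Gamma> m k l p * D m (\<lambda>q. u q c [] []) p)" for k l
  have h_sym: "h k l = h l k" for k l
    unfolding h_def using D_commute[OF p u] christoffel_sym[OF p] by simp
  have N: "N (grad g u) a k p = (\<Sum>l\<in>UNIV. H a l p * h k l)" for a k
    unfolding nabla_vector grad_eq h_def by (intro D_raised p smooth_rules u)
  show ?thesis
    unfolding raised_def N sum_distrib_left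
    by (subst sum.swap) (simp add: h_sym mult_ac)
qed

lemma drift_laplacian_grad:
  assumes p: "p \<in> U" and u: "chart_smooth c (\<lambda>q. u q c [] [])"
  shows "drift_laplacian g f (grad g u) p c [a] [] = drift_transpose (grad g u) a p"
proof -
  let ?T = "raised (grad g u)"
  have "D b (\<lambda>q. ?T a b q - ?T b a q) p = D b (\<lambda>q. 0) p" for b
    by (rule D_cong[OF p]) (use raised_grad_sym[of _ u a b] u in simp)
  then show ?thesis
    using drift_laplacian_minus_transpose[OF p smooth_components_grad[where u = u, OF u], of a]
      raised_grad_sym[where u = u, OF p u, of a]
    by (simp add: D_const)
qed

text \<open>
  Stated for the combination in which \<open>P_op\<close> expresses itself through the other operators, and for
  \<open>Z\<close> given by it on the chart domain only.
\<close>

lemma drift_laplacian_linear: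
  assumes p: "p \<in> U" and smooth: "smooth_components X" "smooth_components Y" "smooth_components W"
    and Z: "\<And>q i. q \<in> U \<Longrightarrow> Z q c [i] [] = r * (X q c [i] [] + Y q c [i] [] + k * W q c [i] [])"
  shows "drift_laplacian g f Z p c [a] [] = r * (drift_laplacian g f X p c [a] []
    + drift_laplacian g f Y p c [a] [] + k * drift_laplacian g f W p c [a] [])"
proof -
  have 1: "N Z i j q = r * (N X i j q + N Y i j q + k * N W i j q)" if "q \<in> U" for i j q
  proof -
    have "D j (\<lambda>q. Z q c [i] []) q = D j (\<lambda>q. r * (X q c [i] [] + Y q c [i] [] + k * W q c [i] [])) q"
      by (rule D_cong[OF that]) (rule Z)
    also have "\<dots> = r * (D j (\<lambda>q. X q c [i] []) q + D j (\<lambda>q. Y q c [i] []) q + k * D j (\<lambda>q. W q c [i] []) q)"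
      by (simp only: D_cmult D_add smooth_tensors smooth that)
    finally show ?thesis
      unfolding nabla_vector Z[OF that] by (simp add: algebra_simps sum.distrib sum_distrib_left)
  qed
  have 2: "NN Z i l j p = r * (NN X i l j p + NN Y i l j p + k * NN W i l j p)" for i l j
  proof -
    have "D l (\<lambda>q. N Z i j q) p = D l (\<lambda>q. r * (N X i j q + N Y i j q + k * N W i j q)) p"
      by (rule D_cong[OF p]) (rule 1)
    also have "\<dots> = r * (D l (\<lambda>q. N X i j q) p + D l (\<lambda>q. N Y i j q) p + k * D l (\<lambda>q. N W i j q) p)"
      by (simp only: D_cmult D_add smooth_tensors smooth p)
    finally show ?thesis
      unfolding nabla_mixed 1[OF p] by (simp add: algebra_simps sum.distrib sum_distrib_left)
  qed
  show ?thesis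
    unfolding drift_laplacian_def laplacian_def nabla_dir_def 1[OF p] 2
    by (simp add: algebra_simps sum.distrib sum_distrib_left)
qed

lemma div_f_linear:
  assumes p: "p \<in> U" and smooth: "smooth_components X" "smooth_components Y" "smooth_components W"
    and Z: "\<And>q i. q \<in> U \<Longrightarrow> Z q c [i] [] = r * (X q c [i] [] + Y q c [i] [] + k * W q c [i] [])"
  shows "div_f g f Z p c [] [] = r * (div_f g f X p c [] [] + div_f g f Y p c [] [] + k * div_f g f W p c [] [])"
proof -
  have "D i (\<lambda>q. Z q c [i] []) p = r * (D i (\<lambda>q. X q c [i] []) p + D i (\<lambda>q. Y q c [i] []) p + k * D i (\<lambda>q. W q c [i] []) p)" for i
  proof -
    have "D i (\<lambda>q. Z q c [i] []) p = D i (\<lambda>q. r * (X q c [i] [] + Y q c [i] [] + k * W q c [i] [])) p"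
      by (rule D_cong[OF p]) (rule Z)
    then show ?thesis by (simp only: D_cmult D_add smooth_tensors smooth p)
  qed
  then show ?thesis
    unfolding div_f_eq[OF p] Z[OF p] by (simp add: algebra_simps sum.distrib sum_distrib_left)
qed

end

section \<open>Gradient Ricci solitons\<close>

locale soliton_chart = weighted_chart c g f for c :: "('a, 'n::finite) chart" and g f +
  fixes \<kappa> :: real
  assumes soliton: "p \<in> U \<Longrightarrow> ricci g p c i j + hessian g f p c i j = \<kappa> * G i j p"
begin

text \<open>
  Compared with \<open>\<nabla>\<^sub>i div\<^sub>f V\<close>, the expression \<open>\<nabla>\<^sub>l \<nabla>\<^sub>i V\<^sup>l - f\<^sub>l \<nabla>\<^sub>i V\<^sup>l\<close> has the extra terms \<open>Ric(V)\<close>, from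
  the Ricci identity, and \<open>Hess f(V)\<close>, from the product rule for \<open>f\<^sub>l V\<^sup>l\<close>. The soliton equation replaces
  their sum by \<open>\<kappa>V\<close>.
\<close>

lemma drift_transpose_eq:
  assumes p: "p \<in> U" and V: "smooth_components V"
  shows "drift_transpose V a p = grad g (div_f g f V) p c [a] [] + \<kappa> * V p c [a] []"
proof -
  let ?v = "\<lambda>l q. V q c [l] []"
  have "(\<Sum>l\<in>UNIV. NN V l l i p - D l f p * N V l i p)
      = D i (\<lambda>q. div_f g f V q c [] []) p + \<kappa> * (\<Sum>l\<in>UNIV. G i l p * ?v l p)" for i
  proof -
    have "D i (\<lambda>q. div_f g f V q c [] []) p
        = D i (\<lambda>q. (\<Sum>l\<in>UNIV. N V l l q) - (\<Sum>l\<in>UNIV. ?v l q * D l f q)) p"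
      by (rule D_cong[OF p]) (rule div_f_nabla)
    also have "\<dots> = D i (\<lambda>q. \<Sum>l\<in>UNIV. N V l l q) p
        - (\<Sum>l\<in>UNIV. ?v l p * D i (D l f) p + D i (?v l) p * D l f p)"
      by (simp only: D_diff[of _ "\<lambda>q. \<Sum>l\<in>UNIV. N V l l q"] D_sum[of _ _ "\<lambda>l q. ?v l q * D l f q"]
          D_mult smooth_tensors smooth_potential V p)
    finally have 1: "D i (\<lambda>q. \<Sum>l\<in>UNIV. N V l l q) p = D i (\<lambda>q. div_f g f V q c [] []) p
        + (\<Sum>l\<in>UNIV. ?v l p * D i (D l f) p) + (\<Sum>l\<in>UNIV. D l f p * D i (?v l) p)"
      by (simp add: sum.distrib mult.commute)
    have 2: "(\<Sum>l\<in>UNIV. D l f p * N V l i p) = (\<Sum>l\<in>UNIV. D l f p * D i (?v l) p)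
        + (\<Sum>l\<in>UNIV. ?v l p * (\<Sum>m\<in>UNIV. \<Gamma> m i l p * D m f p))"
    proof -
      have "(\<Sum>l\<in>UNIV. \<Sum>m\<in>UNIV. D l f p * (\<Gamma> l i m p * ?v m p))
          = (\<Sum>l\<in>UNIV. ?v l p * (\<Sum>m\<in>UNIV. \<Gamma> m i l p * D m f p))"
        unfolding sum_distrib_left by (subst sum.swap) (simp add: mult_ac)
      then show ?thesis unfolding nabla_vector
        by (simp add: distrib_left sum.distrib sum_distrib_left)
    qed
    have "(\<Sum>l\<in>UNIV. NN V l l i p - D l f p * N V l i p) = D i (\<lambda>q. div_f g f V q c [] []) p
        + (\<Sum>l\<in>UNIV. ?v l p * (ricci g p c l i + hessian g f p c i l))"
      unfolding sum_subtractf contracted_ricci_identity[OF p V] 1 2 hessian_eq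
      by (simp add: algebra_simps sum.distrib sum_subtractf)
    also have "(\<Sum>l\<in>UNIV. ?v l p * (ricci g p c l i + hessian g f p c i l)) = \<kappa> * (\<Sum>l\<in>UNIV. G i l p * ?v l p)"
      unfolding hessian_sym[OF p, of i] soliton[OF p] metric_sym[OF p, of _ i]
      by (simp add: sum_distrib_left mult_ac)
    finally show ?thesis .
  qed
  then have "drift_transpose V a p = (\<Sum>i\<in>UNIV. H a i p * D i (\<lambda>q. div_f g f V q c [] []) p)
      + \<kappa> * (\<Sum>i\<in>UNIV. H a i p * (\<Sum>l\<in>UNIV. G i l p * ?v l p))"
    unfolding drift_transpose_def by (simp add: distrib_left sum.distrib sum_distrib_left mult_ac)
  then show ?thesis by (simp only: raise_lower[OF p] grad_eq)
qed

text \<open>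
  The weighted divergences of \<open>\<L>V\<close> and of its transpose agree by \<open>div_f_div_f_antisym\<close>, and the
  transpose is \<open>\<nabla> div\<^sub>f V + \<kappa>V\<close>.
\<close>

lemma div_f_drift_laplacian:
  assumes p: "p \<in> U" and V: "smooth_components V"
  shows "div_f g f (drift_laplacian g f V) p c [] [] =
    div_f g f (grad g (div_f g f V)) p c [] [] + \<kappa> * div_f g f V p c [] []"
proof -
  let ?X = "grad g (div_f g f V)" and ?L = "drift_laplacian g f V"
  have smooth: "smooth_components ?X" "smooth_components ?L"
    using V by (simp_all add: smooth_components_drift_laplacian smooth_components_grad smooth_div_f)
  have "(\<Sum>a\<in>UNIV. D a (\<lambda>q. ?L q c [a] [] - drift_transpose V a q) p
      + drift a p * (?L p c [a] [] - drift_transpose V a p)) = 0"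
    by (rule div_f_div_f_antisym[where B = "\<lambda>a b q. raised V a b q - raised V b a q", OF p])
      (auto simp: drift_laplacian_minus_transpose V smooth_raised intro: chart_smooth_diff)
  moreover have "D a (\<lambda>q. ?L q c [a] [] - drift_transpose V a q) p
      = D a (\<lambda>q. ?L q c [a] []) p - (D a (\<lambda>q. ?X q c [a] []) p + \<kappa> * D a (\<lambda>q. V q c [a] []) p)" for a
  proof -
    have "D a (\<lambda>q. ?L q c [a] [] - drift_transpose V a q) p
        = D a (\<lambda>q. ?L q c [a] [] - (?X q c [a] [] + \<kappa> * V q c [a] [])) p"
      by (rule D_cong[OF p]) (simp only: drift_transpose_eq V)
    then show ?thesis by (simp only: D_diff D_add D_cmult smooth_tensors smooth V p)
  qed
  ultimately show ?thesis
    unfolding div_f_eq[OF p] drift_transpose_eq[OF p V]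
    by (simp add: algebra_simps sum.distrib sum_subtractf sum_distrib_left)
qed

text \<open>
  Both sides equal \<open>\<nabla> div\<^sub>f X + \<kappa>X\<close> for \<open>X = \<nabla> div\<^sub>f V\<close>: the left one because \<open>X\<close> is a gradient field,
  the right one by differentiating \<open>div_f_drift_laplacian\<close>.
\<close>

lemma drift_laplacian_grad_div_f:
  assumes p: "p \<in> U" and V: "smooth_components V"
  shows "drift_laplacian g f (grad g (div_f g f V)) p c [a] [] =
    grad g (div_f g f (drift_laplacian g f V)) p c [a] []"
proof -
  let ?u = "div_f g f V"
  have u: "chart_smooth c (\<lambda>q. ?u q c [] [])" using V by (rule smooth_div_f)
  note X = smooth_components_grad[where u = ?u, OF u]
  have "D l (\<lambda>q. div_f g f (drift_laplacian g f V) q c [] []) p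
      = D l (\<lambda>q. div_f g f (grad g ?u) q c [] []) p + \<kappa> * D l (\<lambda>q. ?u q c [] []) p" for l
  proof -
    have "D l (\<lambda>q. div_f g f (drift_laplacian g f V) q c [] []) p
        = D l (\<lambda>q. div_f g f (grad g ?u) q c [] [] + \<kappa> * ?u q c [] []) p"
      by (rule D_cong[OF p]) (rule div_f_drift_laplacian[OF _ V])
    then show ?thesis by (simp only: D_add D_cmult smooth_rules smooth_div_f X u p)
  qed
  then have "grad g (div_f g f (drift_laplacian g f V)) p c [a] []
      = grad g (div_f g f (grad g ?u)) p c [a] [] + \<kappa> * grad g ?u p c [a] []"
    unfolding grad_eq by (simp add: distrib_left sum.distrib sum_distrib_left mult_ac)
  then show ?thesis
    using drift_laplacian_grad[where u = ?u, OF p u, of a] drift_transpose_eq[OF p X, of a] by simp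
qed

lemma P_op_soliton:
  assumes p: "p \<in> U" and V: "smooth_components V"
  shows "P_op g f V p c [a] [] = - (1/2) * (drift_laplacian g f V p c [a] []
    + grad g (div_f g f V) p c [a] [] + \<kappa> * V p c [a] [])"
  using P_op_eq[OF p V] drift_transpose_eq[OF p V] by (simp only: add.assoc)

lemma drift_laplacian_P_op:
  assumes p: "p \<in> U" and V: "smooth_components V"
  shows "drift_laplacian g f (P_op g f V) p c [a] [] = P_op g f (drift_laplacian g f V) p c [a] []"
proof -
  have smooth: "smooth_components (drift_laplacian g f V)" "smooth_components (grad g (div_f g f V))"
    using V by (simp_all add: smooth_components_drift_laplacian smooth_components_grad smooth_div_f)
  have "drift_laplacian g f (P_op g f V) p c [a] [] =
      - (1/2) * (drift_laplacian g f (drift_laplacian g f V) p c [a] []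
        + drift_laplacian g f (grad g (div_f g f V)) p c [a] []
        + \<kappa> * drift_laplacian g f V p c [a] [])"
    by (rule drift_laplacian_linear[OF p smooth V]) (rule P_op_soliton[OF _ V])
  then show ?thesis
    by (simp only: P_op_soliton[OF p smooth(1)] drift_laplacian_grad_div_f[OF p V])
qed

lemma P_op_grad_div_f:
  assumes p: "p \<in> U" and V: "smooth_components V"
  shows "P_op g f (grad g (div_f g f V)) p c [a] [] = grad g (div_f g f (P_op g f V)) p c [a] []"
proof -
  let ?L = "drift_laplacian g f V" and ?X = "grad g (div_f g f V)"
  have smooth: "smooth_components ?L" "smooth_components ?X"
    using V by (simp_all add: smooth_components_drift_laplacian smooth_components_grad smooth_div_f)
  have D_div: "D l (\<lambda>q. div_f g f (P_op g f V) q c [] []) p = - (1/2) * (D l (\<lambda>q. div_f g f ?L q c [] []) p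
      + D l (\<lambda>q. div_f g f ?X q c [] []) p + \<kappa> * D l (\<lambda>q. div_f g f V q c [] []) p)" for l
  proof -
    have "D l (\<lambda>q. div_f g f (P_op g f V) q c [] []) p = D l (\<lambda>q. - (1/2) * (div_f g f ?L q c [] []
      + div_f g f ?X q c [] [] + \<kappa> * div_f g f V q c [] [])) p"
      by (rule D_cong[OF p], rule div_f_linear[OF _ smooth V], assumption, erule P_op_soliton[OF _ V])
    then show ?thesis by (simp only: D_add D_cmult smooth_rules smooth_div_f smooth V p)
  qed
  have "grad g (div_f g f (P_op g f V)) p c [a] [] = - (1/2) * (grad g (div_f g f ?L) p c [a] []
      + grad g (div_f g f ?X) p c [a] [] + \<kappa> * ?X p c [a] [])"
    unfolding grad_eq D_div sum_distrib_left sum.distrib[symmetric]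
    by (rule sum.cong) (simp_all add: algebra_simps)
  then show ?thesis
    unfolding P_op_soliton[OF p smooth(2)] drift_laplacian_grad_div_f[OF p V] by simp
qed

end

theorem proposition3p5:
  fixes M :: "'a topology"
    and A :: "('a, 'n::finite) chart set"
    and g V :: "('a, 'n) tensor_field"
    and f :: "'a \<Rightarrow> real"
    and \<kappa> :: real
  assumes "gradient_ricci_soliton M A g f \<kappa>"
    and "smooth_vector_field A V"
  shows "vector_field_eq A (drift_laplacian g f (P_op g f V)) (P_op g f (drift_laplacian g f V))
    \<and> vector_field_eq A (P_op g f (grad g (div_f g f V))) (grad g (div_f g f (P_op g f V)))"
proof -
  have chart: "soliton_chart c g f \<kappa>" if "c \<in> A" for c
  proof
    have "is_chart M c"
      using assms(1) that by (auto simp: gradient_ricci_soliton_def smooth_manifold_def)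
    then have "openin M (chart_dom c)" "open (chart_map c ` chart_dom c)"
      and hom: "homeomorphic_map (subtopology M (chart_dom c))
        (top_of_set (chart_map c ` chart_dom c)) (chart_map c)"
      by (auto simp: is_chart_def)
    then show "open (chart_map c ` chart_dom c)" by blast
    have "topspace (subtopology M (chart_dom c)) = chart_dom c"
      using \<open>openin M (chart_dom c)\<close> openin_subset by fastforce
    then show "inj_on (chart_map c) (chart_dom c)"
      using homeomorphic_imp_injective_map[OF hom] by simp
    show "chart_smooth c (\<lambda>q. g q c [] [i, j])" for i j
      using assms(1) that
      by (auto simp: gradient_ricci_soliton_def riemannian_metric_def smooth_tensor_field_def
          chart_smooth_def)
    show "g p c [] [i, j] = g p c [] [j, i]" if "p \<in> chart_dom c" for p i j
      using assms(1) that \<open>c \<in> A\<close>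
      by (auto simp: gradient_ricci_soliton_def riemannian_metric_def)
    show "(\<Sum>i\<in>UNIV. \<Sum>j\<in>UNIV. g p c [] [i, j] * v $ i * v $ j) > 0"
      if "p \<in> chart_dom c" "v \<noteq> 0" for p and v :: "real^'n"
      using assms(1) that \<open>c \<in> A\<close>
      by (auto simp: gradient_ricci_soliton_def riemannian_metric_def)
    show "chart_smooth c f"
      using assms(1) that
      by (auto simp: gradient_ricci_soliton_def smooth_function_def chart_smooth_def)
    show "ricci g p c i j + hessian g f p c i j = \<kappa> * g p c [] [i, j]"
      if "p \<in> chart_dom c" for p i j
      using assms(1) that \<open>c \<in> A\<close> by (auto simp: gradient_ricci_soliton_def)
  qed
  have V: "metric_chart.smooth_components c V" if "c \<in> A" for c
  proof -
    interpret soliton_chart c g f \<kappa> using that by (rule chart)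
    show ?thesis
      using assms(2) that
      by (auto simp: smooth_components_def chart_smooth_def smooth_tensor_field_def)
  qed
  show ?thesis
    unfolding vector_field_eq_def
    by (blast intro: soliton_chart.drift_laplacian_P_op[OF chart _ V]
        soliton_chart.P_op_grad_div_f[OF chart _ V])
qed

end
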